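(* Let $F$ be a field, $\Gamma$ be a group and consider $F$ as a trivially $\Gamma$-graded field. Then $K_0^{\mathrm{gr}}(F) \cong \bigoplus_{\gamma\in\Gamma}\mathbb Z_\gamma$, where $\mathbb Z_\gamma=\mathbb Z$ for each $\gamma\in\Gamma$.
   Context: $\Gamma$ is an arbitrary multiplicative group with identity $e$. $F$ is trivially $\Gamma$-graded: $F_e=F$ and $F_\gamma=0$ for $\gamma\neq e$. For a $\Gamma$-graded ring $R$, $\mathcal P\mathrm{gr}(R)$ is the category of $\Gamma$-graded left $R$-modules ($M=\bigoplus_{\gamma\in\Gamma}M_\gamma$, $R_\gamma M_\delta\subseteq M_{\gamma\delta}$) that are finitely generated and projective, with degree-preserving $R$-module homomorphisms. $K_0^{\mathrm{gr}}(R)=K_0(\mathcal P\mathrm{gr}(R))$ is the abelian group generated by the isomorphism classes $[P]$ of objects of $\mathcal P\mathrm{gr}(R)$ subject to $[P]=[P_1]+[P_2]$ for each short exact sequence $0\to P_1\to P\to P_2\to 0$ in $\mathcal P\mathrm{gr}(R)$ (equivalently, the group completion of the monoid of isomorphism classes under direct sum). *)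

theory Defs
  imports "HOL-Algebra.Algebra"
begin

section \<open>Graded rings and graded modules\<close>

definition internal_direct_sum ::
    "'i set \<Rightarrow> ('m, 'z) ring_scheme \<Rightarrow> ('i \<Rightarrow> 'm set) \<Rightarrow> bool" where
  "internal_direct_sum I M C \<longleftrightarrow>
     (\<forall>i\<in>I. additive_subgroup (C i) M) \<and>
     (\<forall>x\<in>carrier M. \<exists>!c. c \<in> (\<Pi>\<^sub>E i\<in>I. C i) \<and> finite {i\<in>I. c i \<noteq> \<zero>\<^bsub>M\<^esub>} \<and>
        x = (\<Oplus>\<^bsub>M\<^esub>i\<in>{i\<in>I. c i \<noteq> \<zero>\<^bsub>M\<^esub>}. c i))"

locale graded_ring = \<Gamma>: group \<Gamma> + R: ring R
  for \<Gamma> :: "('g, 'd) monoid_scheme" and R :: "('a, 'b) ring_scheme"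
    and A :: "'g \<Rightarrow> 'a set" +
  assumes ring_decomposition: "internal_direct_sum (carrier \<Gamma>) R A"
    and graded_mult: "\<lbrakk>\<gamma> \<in> carrier \<Gamma>; \<delta> \<in> carrier \<Gamma>; a \<in> A \<gamma>; b \<in> A \<delta>\<rbrakk>
      \<Longrightarrow> a \<otimes>\<^bsub>R\<^esub> b \<in> A (\<gamma> \<otimes>\<^bsub>\<Gamma>\<^esub> \<delta>)"

definition trivial_grading ::
    "('g, 'd) monoid_scheme \<Rightarrow> ('a, 'b) ring_scheme \<Rightarrow> 'g \<Rightarrow> 'a set" where
  "trivial_grading \<Gamma> R = (\<lambda>\<gamma>. if \<gamma> = \<one>\<^bsub>\<Gamma>\<^esub> then carrier R else {\<zero>\<^bsub>R\<^esub>})"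

record ('a, 'm, 'g) gr_module = "('a, 'm) module" +
  component :: "'g \<Rightarrow> 'm set"

text \<open>The locale \<^locale>\<open>module\<close> requires the ring to be commutative; this covers the trivially
  graded fields to which the notions below are applied.\<close>

locale graded_module = graded_ring \<Gamma> R A + module R M
  for \<Gamma> :: "('g, 'd) monoid_scheme" and R :: "('a, 'b) ring_scheme"
    and A :: "'g \<Rightarrow> 'a set" and M :: "('a, 'm, 'g) gr_module" +
  assumes module_decomposition: "internal_direct_sum (carrier \<Gamma>) M (component M)"
    and graded_smult: "\<lbrakk>\<gamma> \<in> carrier \<Gamma>; \<delta> \<in> carrier \<Gamma>; a \<in> A \<gamma>; x \<in> component M \<delta>\<rbrakk>
      \<Longrightarrow> a \<odot>\<^bsub>M\<^esub> x \<in> component M (\<gamma> \<otimes>\<^bsub>\<Gamma>\<^esub> \<delta>)"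

definition mod_hom ::
    "('a, 'b) ring_scheme \<Rightarrow> ('a, 'm, 'y) module_scheme \<Rightarrow> ('a, 'n, 'z) module_scheme
      \<Rightarrow> ('m \<Rightarrow> 'n) set" where
  "mod_hom R M N = {f \<in> carrier M \<rightarrow> carrier N.
     (\<forall>x\<in>carrier M. \<forall>y\<in>carrier M. f (x \<oplus>\<^bsub>M\<^esub> y) = f x \<oplus>\<^bsub>N\<^esub> f y) \<and>
     (\<forall>a\<in>carrier R. \<forall>x\<in>carrier M. f (a \<odot>\<^bsub>M\<^esub> x) = a \<odot>\<^bsub>N\<^esub> f x)}"

definition gr_hom ::
    "('g, 'd) monoid_scheme \<Rightarrow> ('a, 'b) ring_scheme \<Rightarrow> ('a, 'm, 'g) gr_module
      \<Rightarrow> ('a, 'n, 'g) gr_module \<Rightarrow> ('m \<Rightarrow> 'n) set" where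
  "gr_hom \<Gamma> R M N =
     {f \<in> mod_hom R M N. \<forall>\<gamma>\<in>carrier \<Gamma>. f ` component M \<gamma> \<subseteq> component N \<gamma>}"

text \<open>The inverse of a bijective graded homomorphism is automatically a graded homomorphism.\<close>

definition gr_isomorphic ::
    "('g, 'd) monoid_scheme \<Rightarrow> ('a, 'b) ring_scheme \<Rightarrow> ('a, 'm, 'g) gr_module
      \<Rightarrow> ('a, 'n, 'g) gr_module \<Rightarrow> bool" where
  "gr_isomorphic \<Gamma> R M N \<longleftrightarrow> (\<exists>f\<in>gr_hom \<Gamma> R M N. bij_betw f (carrier M) (carrier N))"

definition finitely_generated ::
    "('a, 'b) ring_scheme \<Rightarrow> ('a, 'm, 'z) module_scheme \<Rightarrow> bool" where
  "finitely_generated R M \<longleftrightarrow> (\<exists>S. finite S \<and> S \<subseteq> carrier M \<and>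
     (\<forall>x\<in>carrier M. \<exists>c\<in>S \<rightarrow> carrier R. x = (\<Oplus>\<^bsub>M\<^esub>y\<in>S. c y \<odot>\<^bsub>M\<^esub> y)))"

text \<open>Projectivity is the lifting property along surjections \<^term>\<open>g\<close>.  As HOL cannot quantify
  over types, the test modules have carriers in \<^typ>\<open>nat \<Rightarrow> 'a\<close>.  For finitely generated
  \<^term>\<open>M\<close> this loses nothing: up to isomorphism, \<^term>\<open>M\<close> and all the free modules of finite rank
  have such carriers, so the lifting property yields a section of a surjection from a free module
  of finite rank onto \<^term>\<open>M\<close>, hence lifts along arbitrary surjections.\<close>

definition projective ::
    "('a, 'b) ring_scheme \<Rightarrow> ('a, 'm, 'z) module_scheme \<Rightarrow> bool" where
  "projective R M \<longleftrightarrow>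
     (\<forall>(P :: ('a, nat \<Rightarrow> 'a) module) (Q :: ('a, nat \<Rightarrow> 'a) module).
        \<forall>g\<in>mod_hom R P Q. \<forall>f\<in>mod_hom R M Q.
          module R P \<longrightarrow> module R Q \<longrightarrow> g ` carrier P = carrier Q \<longrightarrow>
          (\<exists>h\<in>mod_hom R M P. \<forall>x\<in>carrier M. g (h x) = f x))"

definition Pgr ::
    "('g, 'd) monoid_scheme \<Rightarrow> ('a, 'b) ring_scheme \<Rightarrow> ('g \<Rightarrow> 'a set)
      \<Rightarrow> ('a, 'm, 'g) gr_module set" where
  "Pgr \<Gamma> R A = {M. graded_module \<Gamma> R A M \<and> finitely_generated R M \<and> projective R M}"


section \<open>The graded Grothendieck group\<close>

text \<open>The objects are represented by graded modules with carrier in \<^typ>\<open>nat \<Rightarrow> 'a\<close>; the lemma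
  \<open>Pgr_representative\<close> below shows that every isomorphism class has such representatives.\<close>

type_synonym ('a, 'g) Pgr_object = "('a, nat \<Rightarrow> 'a, 'g) gr_module"

definition iso_class ::
    "('g, 'd) monoid_scheme \<Rightarrow> ('a, 'b) ring_scheme \<Rightarrow> ('g \<Rightarrow> 'a set)
      \<Rightarrow> ('a, 'g) Pgr_object \<Rightarrow> ('a, 'g) Pgr_object set" where
  "iso_class \<Gamma> R A P = {N \<in> Pgr \<Gamma> R A. gr_isomorphic \<Gamma> R P N}"

definition short_exact ::
    "('g, 'd) monoid_scheme \<Rightarrow> ('a, 'b) ring_scheme \<Rightarrow> ('a, 'm, 'g) gr_module
      \<Rightarrow> ('a, 'm, 'g) gr_module \<Rightarrow> ('a, 'm, 'g) gr_module \<Rightarrow> bool" where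
  "short_exact \<Gamma> R P1 P P2 \<longleftrightarrow> (\<exists>f\<in>gr_hom \<Gamma> R P1 P. \<exists>g\<in>gr_hom \<Gamma> R P P2.
     inj_on f (carrier P1) \<and>
     f ` carrier P1 = {x \<in> carrier P. g x = \<zero>\<^bsub>P2\<^esub>} \<and>
     g ` carrier P = carrier P2)"

definition K0gr_relations ::
    "('g, 'd) monoid_scheme \<Rightarrow> ('a, 'b) ring_scheme \<Rightarrow> ('g \<Rightarrow> 'a set)
      \<Rightarrow> (('a, 'g) Pgr_object set \<Rightarrow>\<^sub>0 int) set" where
  "K0gr_relations \<Gamma> R A =
     {frag_of (iso_class \<Gamma> R A P) - (frag_of (iso_class \<Gamma> R A P1) + frag_of (iso_class \<Gamma> R A P2))
      | P1 P P2. P1 \<in> Pgr \<Gamma> R A \<and> P \<in> Pgr \<Gamma> R A \<and> P2 \<in> Pgr \<Gamma> R A \<and> short_exact \<Gamma> R P1 P P2}"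

definition K0gr ::
    "('g, 'd) monoid_scheme \<Rightarrow> ('a, 'b) ring_scheme \<Rightarrow> ('g \<Rightarrow> 'a set)
      \<Rightarrow> (('a, 'g) Pgr_object set \<Rightarrow>\<^sub>0 int) set monoid" where
  "K0gr \<Gamma> R A =
     (let Z = free_Abelian_group (iso_class \<Gamma> R A ` Pgr \<Gamma> R A)
      in Z Mod generate Z (K0gr_relations \<Gamma> R A))"


section \<open>Adequacy of the definitions\<close>

lemma graded_ring_trivial_grading:
  fixes \<Gamma> :: "('g, 'd) monoid_scheme" and R :: "('a, 'b) ring_scheme"
  assumes "group \<Gamma>" "ring R"
  shows "graded_ring \<Gamma> R (trivial_grading \<Gamma> R)"
proof -
  interpret \<Gamma>: group \<Gamma> by fact
  interpret R: ring R by fact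
  let ?A = "trivial_grading \<Gamma> R"
  have sub: "additive_subgroup (?A \<gamma>) R" for \<gamma>
    by (auto simp: trivial_grading_def additive_subgroup_def R.add.subgroup_self
        R.add.triv_subgroup)
  have ex: "\<exists>!c. c \<in> (\<Pi>\<^sub>E i\<in>carrier \<Gamma>. ?A i) \<and> finite {i\<in>carrier \<Gamma>. c i \<noteq> \<zero>\<^bsub>R\<^esub>} \<and>
        x = (\<Oplus>\<^bsub>R\<^esub>i\<in>{i\<in>carrier \<Gamma>. c i \<noteq> \<zero>\<^bsub>R\<^esub>}. c i)" if x: "x \<in> carrier R" for x
  proof (rule ex1I)
    let ?c = "\<lambda>i\<in>carrier \<Gamma>. if i = \<one>\<^bsub>\<Gamma>\<^esub> then x else \<zero>\<^bsub>R\<^esub>"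
    have "{i\<in>carrier \<Gamma>. ?c i \<noteq> \<zero>\<^bsub>R\<^esub>} = (if x = \<zero>\<^bsub>R\<^esub> then {} else {\<one>\<^bsub>\<Gamma>\<^esub>})"
      by auto
    then show "?c \<in> (\<Pi>\<^sub>E i\<in>carrier \<Gamma>. ?A i) \<and> finite {i\<in>carrier \<Gamma>. ?c i \<noteq> \<zero>\<^bsub>R\<^esub>} \<and>
        x = (\<Oplus>\<^bsub>R\<^esub>i\<in>{i\<in>carrier \<Gamma>. ?c i \<noteq> \<zero>\<^bsub>R\<^esub>}. ?c i)"
      using x by (auto simp: trivial_grading_def)
  next
    fix c
    assume c: "c \<in> (\<Pi>\<^sub>E i\<in>carrier \<Gamma>. ?A i) \<and> finite {i\<in>carrier \<Gamma>. c i \<noteq> \<zero>\<^bsub>R\<^esub>} \<and>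
        x = (\<Oplus>\<^bsub>R\<^esub>i\<in>{i\<in>carrier \<Gamma>. c i \<noteq> \<zero>\<^bsub>R\<^esub>}. c i)"
    then have 0: "c i = \<zero>\<^bsub>R\<^esub>" if "i \<in> carrier \<Gamma>" "i \<noteq> \<one>\<^bsub>\<Gamma>\<^esub>" for i
      using that by (auto simp: trivial_grading_def PiE_iff dest!: bspec[where x=i])
    have 1: "c \<one>\<^bsub>\<Gamma>\<^esub> \<in> carrier R"
      using c by (auto simp: trivial_grading_def PiE_iff dest!: bspec[where x="\<one>\<^bsub>\<Gamma>\<^esub>"])
    have "{i\<in>carrier \<Gamma>. c i \<noteq> \<zero>\<^bsub>R\<^esub>} = (if c \<one>\<^bsub>\<Gamma>\<^esub> = \<zero>\<^bsub>R\<^esub> then {} else {\<one>\<^bsub>\<Gamma>\<^esub>})"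
      using 0 by auto
    then have "x = c \<one>\<^bsub>\<Gamma>\<^esub>"
      using c 1 by (auto split: if_splits)
    then show "c = (\<lambda>i\<in>carrier \<Gamma>. if i = \<one>\<^bsub>\<Gamma>\<^esub> then x else \<zero>\<^bsub>R\<^esub>)"
      using c 0 by (auto simp: PiE_iff extensional_def fun_eq_iff)
  qed
  show ?thesis
  proof
    show "internal_direct_sum (carrier \<Gamma>) R ?A"
      using sub ex by (auto simp: internal_direct_sum_def)
  qed (auto simp: trivial_grading_def split: if_splits)
qed

lemma finitely_generated_encoding:
  fixes R :: "('a, 'b) ring_scheme" and M :: "('a, 'm, 'z) module_scheme"
  assumes "module R M" "finitely_generated R M"
  shows "\<exists>\<phi> :: 'm \<Rightarrow> nat \<Rightarrow> 'a. inj_on \<phi> (carrier M)"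
proof -
  interpret module R M by fact
  obtain S where S: "finite S"
      "\<forall>x\<in>carrier M. \<exists>c\<in>S \<rightarrow> carrier R. x = (\<Oplus>\<^bsub>M\<^esub>y\<in>S. c y \<odot>\<^bsub>M\<^esub> y)" "S \<subseteq> carrier M"
    using assms(2) by (auto simp: finitely_generated_def)
  then obtain c where c: "\<And>x. x \<in> carrier M \<Longrightarrow> c x \<in> S \<rightarrow> carrier R"
      "\<And>x. x \<in> carrier M \<Longrightarrow> x = (\<Oplus>\<^bsub>M\<^esub>y\<in>S. c x y \<odot>\<^bsub>M\<^esub> y)"
    by metis
  obtain e :: "'m \<Rightarrow> nat" where e: "inj_on e S"
    using S(1) finite_imp_inj_to_nat_seg by metis
  let ?\<phi> = "\<lambda>x n. c x (inv_into S e n)"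
  have "x = y" if "x \<in> carrier M" "y \<in> carrier M" "?\<phi> x = ?\<phi> y" for x y
  proof -
    have eq: "c x s = c y s" if "s \<in> S" for s
      using fun_cong[OF \<open>?\<phi> x = ?\<phi> y\<close>, of "e s"] e that by simp
    have "(\<Oplus>\<^bsub>M\<^esub>s\<in>S. c x s \<odot>\<^bsub>M\<^esub> s) = (\<Oplus>\<^bsub>M\<^esub>s\<in>S. c y s \<odot>\<^bsub>M\<^esub> s)"
      using eq c(1)[OF that(2)] S(3) by (intro finsum_cong') (auto simp: Pi_iff subset_iff)
    then show ?thesis using c(2) that by metis
  qed
  then have "inj_on ?\<phi> (carrier M)" by (auto intro: inj_onI)
  then show ?thesis by blast
qed

lemma Pgr_representative:
  fixes M :: "('a, 'm, 'g) gr_module" and R :: "('a, 'b) ring_scheme"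
  assumes M: "M \<in> Pgr \<Gamma> R A"
  shows "\<exists>N :: ('a, 'g) Pgr_object. N \<in> Pgr \<Gamma> R A \<and> gr_isomorphic \<Gamma> R M N"
proof -
  interpret M: graded_module \<Gamma> R A M using M by (simp add: Pgr_def)
  obtain \<phi> :: "'m \<Rightarrow> nat \<Rightarrow> 'a" where inj: "inj_on \<phi> (carrier M)"
    using finitely_generated_encoding[OF M.module_axioms] M by (auto simp: Pgr_def)
  define \<psi> where "\<psi> = the_inv_into (carrier M) \<phi>"
  have \<psi>[simp]: "\<psi> (\<phi> x) = x" if "x \<in> carrier M" for x
    using inj that by (simp add: \<psi>_def the_inv_into_f_f)
  define N :: "('a, 'g) Pgr_object" where
    "N = \<lparr>carrier = \<phi> ` carrier M, monoid.mult = undefined, one = undefined, ring.zero = \<phi> \<zero>\<^bsub>M\<^esub>,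
       ring.add = (\<lambda>u v. \<phi> (\<psi> u \<oplus>\<^bsub>M\<^esub> \<psi> v)), smult = (\<lambda>a u. \<phi> (a \<odot>\<^bsub>M\<^esub> \<psi> u)),
       component = (\<lambda>\<gamma>. \<phi> ` component M \<gamma>)\<rparr>"
  have N[simp]: "carrier N = \<phi> ` carrier M" "\<zero>\<^bsub>N\<^esub> = \<phi> \<zero>\<^bsub>M\<^esub>"
      "u \<oplus>\<^bsub>N\<^esub> v = \<phi> (\<psi> u \<oplus>\<^bsub>M\<^esub> \<psi> v)" "a \<odot>\<^bsub>N\<^esub> u = \<phi> (a \<odot>\<^bsub>M\<^esub> \<psi> u)"
      "component N \<gamma> = \<phi> ` component M \<gamma>" for u v a \<gamma>
    by (simp_all add: N_def)
  have sub: "additive_subgroup (component M \<gamma>) M" if "\<gamma> \<in> carrier \<Gamma>" for \<gamma>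
    using M.module_decomposition that by (simp add: internal_direct_sum_def)
  have comp: "component M \<gamma> \<subseteq> carrier M" if "\<gamma> \<in> carrier \<Gamma>" for \<gamma>
    using additive_subgroup.a_subset[OF sub[OF that]] .
  have abN: "abelian_group N"
  proof (rule abelian_groupI)
    fix x assume "x \<in> carrier N"
    then obtain m where m: "m \<in> carrier M" "x = \<phi> m" by auto
    then show "\<exists>y\<in>carrier N. y \<oplus>\<^bsub>N\<^esub> x = \<zero>\<^bsub>N\<^esub>"
      by (intro bexI[of _ "\<phi> (\<ominus>\<^bsub>M\<^esub> m)"]) (auto simp: M.M.l_neg)
  qed (auto simp: M.M.a_ac)
  then interpret N: abelian_group N .
  have modN: "module R N"
    by (rule moduleI) (auto simp: abN M.R.is_cring M.smult_l_distr M.smult_r_distr M.smult_assoc1)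
  have sum: "(\<Oplus>\<^bsub>N\<^esub>i\<in>I. \<phi> (c i)) = \<phi> (\<Oplus>\<^bsub>M\<^esub>i\<in>I. c i)"
    if "finite I" "c \<in> I \<rightarrow> carrier M" for I and c :: "'i \<Rightarrow> 'm"
    using that
  proof (induction I)
    case (insert i I)
    have "(\<lambda>i. \<phi> (c i)) \<in> I \<rightarrow> carrier N" "\<phi> (c i) \<in> carrier N" "c i \<in> carrier M" "c \<in> I \<rightarrow> carrier M"
      using insert.prems by auto
    then show ?case using insert by simp
  qed simp
  have \<phi>eq: "\<phi> x = \<phi> y \<longleftrightarrow> x = y" if "x \<in> carrier M" "y \<in> carrier M" for x y
    using inj that by (auto dest: inj_onD)
  have "internal_direct_sum (carrier \<Gamma>) N (component N)"
    unfolding internal_direct_sum_def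
  proof (intro conjI ballI)
    fix \<gamma> assume g: "\<gamma> \<in> carrier \<Gamma>"
    interpret C: additive_subgroup "component M \<gamma>" M using sub[OF g] .
    show "additive_subgroup (component N \<gamma>) N"
    proof (rule additive_subgroup.intro, rule N.add.subgroupI)
      fix a assume "a \<in> component N \<gamma>"
      then obtain m where m: "m \<in> component M \<gamma>" "a = \<phi> m" by auto
      then have "m \<in> carrier M" "\<ominus>\<^bsub>M\<^esub> m \<in> component M \<gamma>"
        using C.a_subset C.a_inv_closed by auto
      then have "\<ominus>\<^bsub>N\<^esub> a = \<phi> (\<ominus>\<^bsub>M\<^esub> m)"
        using m by (intro N.minus_equality) (auto simp: M.M.l_neg)
      then show "\<ominus>\<^bsub>N\<^esub> a \<in> component N \<gamma>"
        using \<open>\<ominus>\<^bsub>M\<^esub> m \<in> component M \<gamma>\<close> by simp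
    qed (use comp[OF g] C.zero_closed C.a_closed in \<open>auto simp: subset_iff simp del: C.zero_closed\<close>)
  next
    fix x assume "x \<in> carrier N"
    then obtain m where m: "m \<in> carrier M" "x = \<phi> m" by auto
    let ?P = "\<lambda>m c. c \<in> (\<Pi>\<^sub>E i\<in>carrier \<Gamma>. component M i) \<and> finite {i\<in>carrier \<Gamma>. c i \<noteq> \<zero>\<^bsub>M\<^esub>} \<and>
        m = (\<Oplus>\<^bsub>M\<^esub>i\<in>{i\<in>carrier \<Gamma>. c i \<noteq> \<zero>\<^bsub>M\<^esub>}. c i)"
    let ?Q = "\<lambda>x c. c \<in> (\<Pi>\<^sub>E i\<in>carrier \<Gamma>. component N i) \<and> finite {i\<in>carrier \<Gamma>. c i \<noteq> \<zero>\<^bsub>N\<^esub>} \<and>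
        x = (\<Oplus>\<^bsub>N\<^esub>i\<in>{i\<in>carrier \<Gamma>. c i \<noteq> \<zero>\<^bsub>N\<^esub>}. c i)"
    have ex1: "\<exists>!c. ?P m c"
      using M.module_decomposition[unfolded internal_direct_sum_def, THEN conjunct2, THEN bspec, OF m(1)] .
    define c where "c = (THE c. ?P m c)"
    have c: "?P m c"
      unfolding c_def by (rule theI'[OF ex1])
    have uniq: "c' = c" if "?P m c'" for c'
    proof -
      define Z where "Z = ?P m"
      have "\<exists>!c. Z c" "Z c'" "Z c"
        unfolding Z_def by (fact ex1, fact that, fact c)
      then show ?thesis by blast
    qed
    have supp: "{i\<in>carrier \<Gamma>. d i \<noteq> \<zero>\<^bsub>N\<^esub>} = {i\<in>carrier \<Gamma>. c i \<noteq> \<zero>\<^bsub>M\<^esub>}"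
      and tr: "(\<Oplus>\<^bsub>N\<^esub>i\<in>{i\<in>carrier \<Gamma>. c i \<noteq> \<zero>\<^bsub>M\<^esub>}. d i) = \<phi> (\<Oplus>\<^bsub>M\<^esub>i\<in>{i\<in>carrier \<Gamma>. c i \<noteq> \<zero>\<^bsub>M\<^esub>}. c i)"
      if c: "c \<in> (\<Pi>\<^sub>E i\<in>carrier \<Gamma>. component M i)" and f: "finite {i\<in>carrier \<Gamma>. c i \<noteq> \<zero>\<^bsub>M\<^esub>}"
        and d: "\<And>i. i \<in> carrier \<Gamma> \<Longrightarrow> d i = \<phi> (c i)" for c d
    proof -
      have cM: "c i \<in> carrier M" if "i \<in> carrier \<Gamma>" for i
        using c comp that by (auto simp: PiE_iff)
      show "{i\<in>carrier \<Gamma>. d i \<noteq> \<zero>\<^bsub>N\<^esub>} = {i\<in>carrier \<Gamma>. c i \<noteq> \<zero>\<^bsub>M\<^esub>}"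
        using cM d \<phi>eq by auto
      have "(\<Oplus>\<^bsub>N\<^esub>i\<in>{i\<in>carrier \<Gamma>. c i \<noteq> \<zero>\<^bsub>M\<^esub>}. d i) = (\<Oplus>\<^bsub>N\<^esub>i\<in>{i\<in>carrier \<Gamma>. c i \<noteq> \<zero>\<^bsub>M\<^esub>}. \<phi> (c i))"
        using cM d by (intro N.finsum_cong') auto
      also have "\<dots> = \<phi> (\<Oplus>\<^bsub>M\<^esub>i\<in>{i\<in>carrier \<Gamma>. c i \<noteq> \<zero>\<^bsub>M\<^esub>}. c i)"
        using f cM by (intro sum) auto
      finally show "(\<Oplus>\<^bsub>N\<^esub>i\<in>{i\<in>carrier \<Gamma>. c i \<noteq> \<zero>\<^bsub>M\<^esub>}. d i) = \<phi> (\<Oplus>\<^bsub>M\<^esub>i\<in>{i\<in>carrier \<Gamma>. c i \<noteq> \<zero>\<^bsub>M\<^esub>}. c i)" .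
    qed
    show "\<exists>!d. ?Q x d"
    proof (rule ex1I)
      show "?Q x (\<lambda>i\<in>carrier \<Gamma>. \<phi> (c i))"
        using c supp[of c "\<lambda>i\<in>carrier \<Gamma>. \<phi> (c i)"] tr[of c "\<lambda>i\<in>carrier \<Gamma>. \<phi> (c i)"] m(2)
        by (auto simp: PiE_iff simp del: N(2))
    next
      fix d assume d: "?Q x d"
      define c' where "c' = (\<lambda>i\<in>carrier \<Gamma>. \<psi> (d i))"
      have dN: "d i \<in> \<phi> ` component M i" if "i \<in> carrier \<Gamma>" for i
        using d that by (auto simp: PiE_iff)
      have dc': "c' i \<in> component M i \<and> d i = \<phi> (c' i)" if i: "i \<in> carrier \<Gamma>" for i
      proof -
        obtain z where "z \<in> component M i" "d i = \<phi> z" using dN[OF i] by auto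
        then show ?thesis using comp[OF i] i by (auto simp: c'_def)
      qed
      then have dc: "\<And>i. i \<in> carrier \<Gamma> \<Longrightarrow> d i = \<phi> (c' i)" by blast
      have c': "c' \<in> (\<Pi>\<^sub>E i\<in>carrier \<Gamma>. component M i)"
        using dc' by (auto simp: PiE_iff c'_def)
      have cM: "c' i \<in> carrier M" if "i \<in> carrier \<Gamma>" for i
        using c' comp that by (auto simp: PiE_iff)
      have "{i\<in>carrier \<Gamma>. d i \<noteq> \<zero>\<^bsub>N\<^esub>} = {i\<in>carrier \<Gamma>. c' i \<noteq> \<zero>\<^bsub>M\<^esub>}"
        using cM dc \<phi>eq by auto
      then have f: "finite {i\<in>carrier \<Gamma>. c' i \<noteq> \<zero>\<^bsub>M\<^esub>}" using d by (simp del: N(2))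
      have "x = (\<Oplus>\<^bsub>N\<^esub>i\<in>{i\<in>carrier \<Gamma>. d i \<noteq> \<zero>\<^bsub>N\<^esub>}. d i)"
        using d by blast
      then have "\<phi> m = \<phi> (\<Oplus>\<^bsub>M\<^esub>i\<in>{i\<in>carrier \<Gamma>. c' i \<noteq> \<zero>\<^bsub>M\<^esub>}. c' i)"
        using supp[OF c' f dc] tr[OF c' f dc] m(2) by (simp del: N(2))
      moreover have "(\<Oplus>\<^bsub>M\<^esub>i\<in>{i\<in>carrier \<Gamma>. c' i \<noteq> \<zero>\<^bsub>M\<^esub>}. c' i) \<in> carrier M"
        using cM by (intro M.M.finsum_closed) auto
      ultimately have "m = (\<Oplus>\<^bsub>M\<^esub>i\<in>{i\<in>carrier \<Gamma>. c' i \<noteq> \<zero>\<^bsub>M\<^esub>}. c' i)"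
        using \<phi>eq m(1) by blast
      then have "c' = c" by (intro uniq conjI c' f)
      then show "d = (\<lambda>i\<in>carrier \<Gamma>. \<phi> (c i))"
        using d dc by (auto simp: PiE_iff extensional_def fun_eq_iff)
    qed
  qed
  moreover have "a \<odot>\<^bsub>N\<^esub> x \<in> component N (\<gamma> \<otimes>\<^bsub>\<Gamma>\<^esub> \<delta>)"
    if h: "\<gamma> \<in> carrier \<Gamma>" "\<delta> \<in> carrier \<Gamma>" "a \<in> A \<gamma>" "x \<in> component N \<delta>" for \<gamma> \<delta> a x
  proof -
    obtain m where "m \<in> component M \<delta>" "x = \<phi> m" using h(4) by auto
    then show ?thesis using comp[OF h(2)] M.graded_smult[OF h(1-3)] by auto
  qed
  ultimately have "graded_module \<Gamma> R A N"
    by (rule graded_module.intro[OF M.graded_ring_axioms modN graded_module_axioms.intro])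
  moreover have "finitely_generated R N"
  proof -
    obtain S where S: "finite S" "S \<subseteq> carrier M"
      "\<forall>x\<in>carrier M. \<exists>c\<in>S \<rightarrow> carrier R. x = (\<Oplus>\<^bsub>M\<^esub>y\<in>S. c y \<odot>\<^bsub>M\<^esub> y)"
      using M by (auto simp: Pgr_def finitely_generated_def)
    have "\<exists>c\<in>\<phi> ` S \<rightarrow> carrier R. \<phi> x = (\<Oplus>\<^bsub>N\<^esub>y\<in>\<phi> ` S. c y \<odot>\<^bsub>N\<^esub> y)" if x: "x \<in> carrier M" for x
    proof -
      obtain c where c: "c \<in> S \<rightarrow> carrier R" "x = (\<Oplus>\<^bsub>M\<^esub>y\<in>S. c y \<odot>\<^bsub>M\<^esub> y)"
        using S(3) x by metis
      have "(\<Oplus>\<^bsub>N\<^esub>y\<in>\<phi> ` S. c (\<psi> y) \<odot>\<^bsub>N\<^esub> y) = (\<Oplus>\<^bsub>N\<^esub>y\<in>S. c (\<psi> (\<phi> y)) \<odot>\<^bsub>N\<^esub> \<phi> y)"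
        using S(2) c(1) by (intro N.finsum_reindex inj_on_subset[OF inj]) (auto simp: Pi_iff subset_iff)
      also have "\<dots> = (\<Oplus>\<^bsub>N\<^esub>y\<in>S. \<phi> (c y \<odot>\<^bsub>M\<^esub> y))"
        using S(2) c(1) by (intro N.finsum_cong') (auto simp: Pi_iff subset_iff)
      also have "\<dots> = \<phi> x"
        unfolding c(2) using S c(1) by (intro sum) (auto simp: Pi_iff subset_iff)
      finally show ?thesis
        using S(2) c(1) by (intro bexI[of _ "\<lambda>y. c (\<psi> y)"]) (auto simp: Pi_iff subset_iff)
    qed
    then show ?thesis
      using S(1,2) unfolding finitely_generated_def
      by (intro exI[of _ "\<phi> ` S"]) auto
  qed
  moreover have "projective R N"
    unfolding projective_def
  proof (intro allI ballI impI)
    fix P Q :: "('a, nat \<Rightarrow> 'a) module" and g f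
    assume gf: "g \<in> mod_hom R P Q" "f \<in> mod_hom R N Q" "module R P" "module R Q" "g ` carrier P = carrier Q"
    have "f \<circ> \<phi> \<in> mod_hom R M Q"
      using gf(2) by (auto simp: mod_hom_def)
    moreover have "projective R M" using M by (simp add: Pgr_def)
    ultimately have "\<exists>h\<in>mod_hom R M P. \<forall>x\<in>carrier M. g (h x) = (f \<circ> \<phi>) x"
      unfolding projective_def using gf(1,3-5) by blast
    then obtain h where h: "h \<in> mod_hom R M P" "\<forall>x\<in>carrier M. g (h x) = f (\<phi> x)"
      by auto
    have "h \<circ> \<psi> \<in> mod_hom R N P"
      using h(1) by (auto simp: mod_hom_def Pi_iff)
    then show "\<exists>h\<in>mod_hom R N P. \<forall>x\<in>carrier N. g (h x) = f x"
      using h(2) by (intro bexI[of _ "h \<circ> \<psi>"]) auto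
  qed
  moreover have "\<phi> \<in> gr_hom \<Gamma> R M N"
    by (auto simp: gr_hom_def mod_hom_def)
  then have "gr_isomorphic \<Gamma> R M N"
    using inj by (auto simp: gr_isomorphic_def bij_betw_def)
  ultimately show ?thesis by (auto simp: Pgr_def)
qed

end

theory Submission
  imports Defs
begin

text \<open>A finitely generated graded vector space \<open>M\<close> has a homogeneous basis.  Every homogeneous
  basis contains, for each degree \<open>\<gamma>\<close>, a basis of \<open>M\<^sub>\<gamma>\<close>, so the formal sum of the degrees of its
  members depends only on \<open>M\<close>, and lifting bases shows that it is additive on short exact
  sequences.  This gives a homomorphism from \<open>K\<^sub>0\<close> to the free abelian group on \<open>\<Gamma>\<close>.  Splitting off
  one basis vector at a time writes the class of \<open>M\<close> as a sum of classes of one-dimensional spaces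
  concentrated in a single degree; hence sending \<open>\<gamma>\<close> to the class of the one-dimensional space in
  degree \<open>\<gamma>\<close> defines the inverse.\<close>

text \<open>The number of basis members of degree \<open>\<gamma>\<close> is the dimension of
  \<open>M\<^sub>\<gamma>\<close>. It is well defined because the field sits in degree
  \<open>\<one>\<close>: the projections onto the homogeneous components are linear, so an element
  of \<open>M\<^sub>\<gamma>\<close> involves only basis members of degree \<open>\<gamma>\<close>.
  Two bases can then be compared one degree at a time, using that a homogeneous linear system with
  more unknowns than equations has a nontrivial solution. The classes in \<open>K0gr\<close> consist
  of modules with carriers in \<open>nat \<Rightarrow> 'a\<close>. The chosen bases are therefore
  indexed by finite sets of natural numbers, and each class is represented by a free module made of
  functions on \<open>nat\<close> that vanish outside such a set. Well-definedness of the inverse on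
  the quotient is never checked directly. The work happens in the free abelian group on the classes:
  modulo the relations each class equals the sum of one-dimensional classes prescribed by its
  degrees, so an element with zero degree sum already lies in the subgroup of relations. That
  subgroup is thus the exact kernel of the degree map.\<close>

section \<open>Homogeneous linear systems over a field\<close>

text \<open>Gaussian elimination, by induction on the equations; \<open>a i j\<close> is the
  coefficient of the unknown \<open>i\<close> in the equation \<open>j\<close>. A new equation with
  only zero coefficients costs nothing; any other is used to eliminate one unknown, so that both
  counts drop by one.\<close>

lemma (in field) exists_nontrivial_solution:
  assumes "finite J" "finite I" "card J < card I"
    and "\<And>i j. i \<in> I \<Longrightarrow> j \<in> J \<Longrightarrow> a i j \<in> carrier R"
  shows "\<exists>c\<in>I \<rightarrow> carrier R. (\<exists>i\<in>I. c i \<noteq> \<zero>) \<and> (\<forall>j\<in>J. (\<Oplus>i\<in>I. a i j \<otimes> c i) = \<zero>)"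
  using assms
proof (induction J arbitrary: I a)
  case empty
  then obtain i where "i \<in> I" by fastforce
  then show ?case by (intro bexI[of _ "\<lambda>_. \<one>"]) auto
next
  case (insert j J)
  have J: "card J < card I" using insert by simp
  show ?case
  proof (cases "\<forall>i\<in>I. a i j = \<zero>")
    case True
    obtain c where c: "c \<in> I \<rightarrow> carrier R" "\<exists>i\<in>I. c i \<noteq> \<zero>" "\<forall>j\<in>J. (\<Oplus>i\<in>I. a i j \<otimes> c i) = \<zero>"
      using insert.IH[OF insert.prems(1) J, of a] insert.prems by auto
    have "(\<Oplus>i\<in>I. a i j \<otimes> c i) = \<zero>"
      using True c(1) by (intro add.finprod_one_eqI) (auto simp: Pi_iff)
    with c show ?thesis by blast
  next
    case False
    then obtain k where k: "k \<in> I" "a k j \<noteq> \<zero>" by blast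
    let ?I = "I - {k}"
    \<comment> \<open>\<open>u l\<close> is the multiple of equation \<open>j\<close> whose
      subtraction from equation \<open>l\<close> removes the unknown \<open>k\<close>.\<close>
    define u where "u l = inv (a k j) \<otimes> a k l" for l
    have akj: "a k j \<in> Units R" using k insert.prems by (auto simp: field_Units)
    have u: "u l \<in> carrier R" if "l \<in> insert j J" for l
      unfolding u_def using akj insert.prems(3)[OF k(1) that] by simp
    have uj: "u j = \<one>" using akj by (simp add: u_def)
    define a' where "a' i l = a i l \<ominus> u l \<otimes> a i j" for i l
    have a: "a i l \<in> carrier R" if "i \<in> I" "l \<in> insert j J" for i l using insert.prems that by blast
    have "card J < card ?I" using insert.prems insert.hyps k by simp
    moreover have "a' i l \<in> carrier R" if "i \<in> ?I" "l \<in> J" for i l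
      using that a u by (auto simp: a'_def)
    ultimately obtain c where c: "c \<in> ?I \<rightarrow> carrier R" "\<exists>i\<in>?I. c i \<noteq> \<zero>"
        "\<forall>j\<in>J. (\<Oplus>i\<in>?I. a' i j \<otimes> c i) = \<zero>"
      using insert.IH[of ?I a'] insert.prems(1) by auto
    define s where "s = (\<Oplus>i\<in>?I. a i j \<otimes> c i)"
    have s: "s \<in> carrier R" unfolding s_def using c(1) a by (intro finsum_closed) auto
    \<comment> \<open>The value at \<open>k\<close> is forced: it solves equation \<open>j\<close>
      once the other unknowns are given by \<open>c\<close>.\<close>
    define c' where "c' = c(k := \<ominus> (inv (a k j) \<otimes> s))"
    have c': "c' \<in> I \<rightarrow> carrier R" using c(1) s akj by (auto simp: c'_def)
    have "(\<Oplus>i\<in>I. a i l \<otimes> c' i) = \<zero>" if l: "l \<in> insert j J" for l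
    proof -
      have ac: "a i l \<otimes> c i \<in> carrier R" "a i j \<otimes> c i \<in> carrier R" "c i \<in> carrier R"
        if "i \<in> ?I" for i using that l a c(1) by auto
      have "(\<Oplus>i\<in>?I. a' i l \<otimes> c i) = (\<Oplus>i\<in>?I. a i l \<otimes> c i \<oplus> (\<ominus> u l) \<otimes> (a i j \<otimes> c i))"
        using ac u[OF l] a l unfolding a'_def
        by (intro finsum_cong') (auto simp: minus_eq l_distr l_minus m_assoc)
      also have "\<dots> = (\<Oplus>i\<in>?I. a i l \<otimes> c i) \<oplus> (\<ominus> u l) \<otimes> s"
        using ac u[OF l] insert.prems(1) unfolding s_def
        by (subst finsum_rdistr) (auto intro!: finsum_addf)
      finally have eq: "(\<Oplus>i\<in>?I. a' i l \<otimes> c i) = (\<Oplus>i\<in>?I. a i l \<otimes> c i) \<oplus> (\<ominus> u l) \<otimes> s" .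
      \<comment> \<open>For \<open>l = j\<close> the multiplier is \<open>\<one>\<close>, so every
        \<open>a' i j\<close> vanishes. Hence the pivot equation and the remaining ones are verified
        by one and the same computation.\<close>
      have z: "(\<Oplus>i\<in>?I. a' i l \<otimes> c i) = \<zero>"
      proof (cases "l = j")
        case True
        then show ?thesis using a ac uj
          by (intro add.finprod_one_eqI) (auto simp: a'_def minus_eq r_neg)
      qed (use l c(3) in auto)
      have "(\<Oplus>i\<in>I. a i l \<otimes> c' i) = (\<Oplus>i\<in>insert k ?I. a i l \<otimes> c' i)"
        by (simp only: insert_Diff[OF k(1)])
      also have "\<dots> = a k l \<otimes> c' k \<oplus> (\<Oplus>i\<in>?I. a i l \<otimes> c' i)"
        using c' a l k insert.prems(1) by (intro finsum_insert) auto
      also have "(\<Oplus>i\<in>?I. a i l \<otimes> c' i) = (\<Oplus>i\<in>?I. a i l \<otimes> c i)"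
        using ac by (intro finsum_cong') (auto simp: c'_def)
      also have "a k l \<otimes> c' k = (\<ominus> u l) \<otimes> s"
        using akj s a[OF k(1) l] by (simp add: c'_def u_def l_minus r_minus m_ac)
      also have "(\<ominus> u l) \<otimes> s \<oplus> (\<Oplus>i\<in>?I. a i l \<otimes> c i) = \<zero>"
        using eq z ac u[OF l] s by (simp add: a_comm)
      finally show ?thesis .
    qed
    moreover have "\<exists>i\<in>I. c' i \<noteq> \<zero>" using c(2) by (auto simp: c'_def)
    ultimately show ?thesis using c' by blast
  qed
qed

section \<open>Linear combinations\<close>

text \<open>Families are used instead of sets of vectors: a map \<open>f\<close> carries a family
  \<open>b\<close> to \<open>f \<circ> b\<close> over the same index set, with the same degrees
  attached, and two families are joined over \<open>I <+> J\<close> without any disjointness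
  condition.\<close>

definition lincomb :: "('a, 'm, 'z) module_scheme \<Rightarrow> 'i set \<Rightarrow> ('i \<Rightarrow> 'a) \<Rightarrow> ('i \<Rightarrow> 'm) \<Rightarrow> 'm" where
  "lincomb M I c b = (\<Oplus>\<^bsub>M\<^esub>i\<in>I. c i \<odot>\<^bsub>M\<^esub> b i)"

context module
begin

lemma lincomb_closed [intro]:
  "\<lbrakk>c \<in> I \<rightarrow> carrier R; b \<in> I \<rightarrow> carrier M\<rbrakk> \<Longrightarrow> lincomb M I c b \<in> carrier M"
  unfolding lincomb_def by (intro M.finsum_closed) auto

text \<open>Terms are compared, not coefficients and vectors separately, so that a zero coefficient
  can be traded for a zero vector.\<close>

lemma lincomb_cong:
  assumes "\<And>i. i \<in> I \<Longrightarrow> c i \<odot>\<^bsub>M\<^esub> b i = c' i \<odot>\<^bsub>M\<^esub> b' i"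
    and "c' \<in> I \<rightarrow> carrier R" "b' \<in> I \<rightarrow> carrier M"
  shows "lincomb M I c b = lincomb M I c' b'"
  unfolding lincomb_def using assms by (intro M.finsum_cong') auto

lemma lincomb_subset:
  assumes "finite I" "J \<subseteq> I" "\<And>i. i \<in> I - J \<Longrightarrow> c i = \<zero>"
    and "c \<in> I \<rightarrow> carrier R" "b \<in> I \<rightarrow> carrier M"
  shows "lincomb M I c b = lincomb M J c b"
  unfolding lincomb_def using assms by (intro M.add.finprod_mono_neutral_cong_right) (auto simp: Pi_iff)

lemma lincomb_insert:
  assumes "finite I" "i \<notin> I" "c \<in> insert i I \<rightarrow> carrier R" "b \<in> insert i I \<rightarrow> carrier M"
  shows "lincomb M (insert i I) c b = c i \<odot>\<^bsub>M\<^esub> b i \<oplus>\<^bsub>M\<^esub> lincomb M I c b"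
  unfolding lincomb_def using assms by (subst M.finsum_insert) auto

lemma lincomb_single:
  assumes "finite I" "i \<in> I" "b \<in> I \<rightarrow> carrier M" "a \<in> carrier R"
  shows "lincomb M I (\<lambda>j. if j = i then a else \<zero>) b = a \<odot>\<^bsub>M\<^esub> b i"
proof -
  have bi: "b i \<in> carrier M" using assms by auto
  have "lincomb M I (\<lambda>j. if j = i then a else \<zero>) b = lincomb M {i} (\<lambda>j. if j = i then a else \<zero>) b"
    using assms by (intro lincomb_subset) auto
  also have "\<dots> = a \<odot>\<^bsub>M\<^esub> b i" using bi assms(4) by (simp add: lincomb_def)
  finally show ?thesis .
qed

lemma lincomb_add:
  assumes "c \<in> I \<rightarrow> carrier R" "c' \<in> I \<rightarrow> carrier R" "b \<in> I \<rightarrow> carrier M"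
  shows "lincomb M I (\<lambda>i. c i \<oplus> c' i) b = lincomb M I c b \<oplus>\<^bsub>M\<^esub> lincomb M I c' b"
proof -
  have "lincomb M I (\<lambda>i. c i \<oplus> c' i) b = (\<Oplus>\<^bsub>M\<^esub>i\<in>I. c i \<odot>\<^bsub>M\<^esub> b i \<oplus>\<^bsub>M\<^esub> c' i \<odot>\<^bsub>M\<^esub> b i)"
    unfolding lincomb_def using assms by (intro M.finsum_cong') (auto intro!: smult_l_distr M.a_closed)
  also have "\<dots> = lincomb M I c b \<oplus>\<^bsub>M\<^esub> lincomb M I c' b"
    unfolding lincomb_def using assms by (intro M.finsum_addf) auto
  finally show ?thesis .
qed

lemma lincomb_smult:
  assumes "finite I" "c \<in> I \<rightarrow> carrier R" "a \<in> carrier R" "b \<in> I \<rightarrow> carrier M"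
  shows "lincomb M I (\<lambda>i. a \<otimes> c i) b = a \<odot>\<^bsub>M\<^esub> lincomb M I c b"
proof -
  have "a \<odot>\<^bsub>M\<^esub> lincomb M I c b = (\<Oplus>\<^bsub>M\<^esub>i\<in>I. a \<odot>\<^bsub>M\<^esub> (c i \<odot>\<^bsub>M\<^esub> b i))"
    unfolding lincomb_def using assms by (intro finsum_smult_ldistr) auto
  also have "\<dots> = lincomb M I (\<lambda>i. a \<otimes> c i) b"
    unfolding lincomb_def using assms by (intro M.finsum_cong') (auto intro!: smult_assoc1[symmetric])
  finally show ?thesis ..
qed

lemma lincomb_diff:
  assumes "finite I" "c \<in> I \<rightarrow> carrier R" "c' \<in> I \<rightarrow> carrier R" "b \<in> I \<rightarrow> carrier M"
  shows "lincomb M I (\<lambda>i. c i \<ominus> c' i) b = lincomb M I c b \<ominus>\<^bsub>M\<^esub> lincomb M I c' b"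
proof -
  have "lincomb M I (\<lambda>i. c i \<ominus> c' i) b = lincomb M I (\<lambda>i. c i \<oplus> \<ominus> \<one> \<otimes> c' i) b"
    using assms by (intro lincomb_cong) (auto simp: R.minus_eq R.l_minus Pi_iff)
  also have "\<dots> = lincomb M I c b \<oplus>\<^bsub>M\<^esub> (\<ominus> \<one>) \<odot>\<^bsub>M\<^esub> lincomb M I c' b"
    using assms by (subst lincomb_add) (auto simp: lincomb_smult)
  also have "(\<ominus> \<one>) \<odot>\<^bsub>M\<^esub> lincomb M I c' b = \<ominus>\<^bsub>M\<^esub> lincomb M I c' b"
    using lincomb_closed[OF assms(3,4)] by (simp add: smult_l_minus)
  finally show ?thesis by (simp add: M.minus_eq)
qed

lemma lincomb_Plus:
  assumes "finite I" "finite J" "c \<in> I <+> J \<rightarrow> carrier R" "b \<in> I <+> J \<rightarrow> carrier M"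
  shows "lincomb M (I <+> J) c b
    = lincomb M I (c \<circ> Inl) (b \<circ> Inl) \<oplus>\<^bsub>M\<^esub> lincomb M J (c \<circ> Inr) (b \<circ> Inr)"
proof -
  have "lincomb M (I <+> J) c b = (\<Oplus>\<^bsub>M\<^esub>i\<in>Inl ` I. c i \<odot>\<^bsub>M\<^esub> b i) \<oplus>\<^bsub>M\<^esub> (\<Oplus>\<^bsub>M\<^esub>i\<in>Inr ` J. c i \<odot>\<^bsub>M\<^esub> b i)"
    unfolding lincomb_def Plus_def using assms by (intro M.finsum_Un_disjoint) auto
  also have "(\<Oplus>\<^bsub>M\<^esub>i\<in>Inl ` I. c i \<odot>\<^bsub>M\<^esub> b i) = lincomb M I (c \<circ> Inl) (b \<circ> Inl)"
    unfolding lincomb_def comp_def using assms by (intro M.finsum_reindex) auto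
  also have "(\<Oplus>\<^bsub>M\<^esub>i\<in>Inr ` J. c i \<odot>\<^bsub>M\<^esub> b i) = lincomb M J (c \<circ> Inr) (b \<circ> Inr)"
    unfolding lincomb_def comp_def using assms by (intro M.finsum_reindex) auto
  finally show ?thesis .
qed

text \<open>Interchange of two finite sums, by induction on the outer one. The resulting
  coefficients have the shape of the left-hand sides in
  \<open>exists_nontrivial_solution\<close>.\<close>

lemma lincomb_lincomb:
  assumes "finite I" "finite J" "c \<in> I \<rightarrow> carrier R" "w \<in> J \<rightarrow> carrier M"
    and "\<And>i j. i \<in> I \<Longrightarrow> j \<in> J \<Longrightarrow> a i j \<in> carrier R"
  shows "lincomb M I c (\<lambda>i. lincomb M J (a i) w) = lincomb M J (\<lambda>j. \<Oplus>i\<in>I. a i j \<otimes> c i) w"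
  using assms(1,3,5)
proof (induction I)
  case empty
  then show ?case using assms(4)
    by (auto simp: lincomb_def Pi_iff intro!: M.add.finprod_one_eqI[symmetric])
next
  case (insert i I)
  have ai: "a i \<in> J \<rightarrow> carrier R" and ci: "c i \<in> carrier R" using insert by auto
  have s: "(\<lambda>j. \<Oplus>i\<in>I. a i j \<otimes> c i) \<in> J \<rightarrow> carrier R"
    using insert by (auto intro!: R.finsum_closed)
  have "lincomb M (insert i I) c (\<lambda>i. lincomb M J (a i) w)
      = c i \<odot>\<^bsub>M\<^esub> lincomb M J (a i) w \<oplus>\<^bsub>M\<^esub> lincomb M I c (\<lambda>i. lincomb M J (a i) w)"
    using insert assms(4) by (intro lincomb_insert) (auto intro!: lincomb_closed)
  also have "\<dots> = lincomb M J (\<lambda>j. c i \<otimes> a i j) w \<oplus>\<^bsub>M\<^esub> lincomb M J (\<lambda>j. \<Oplus>i\<in>I. a i j \<otimes> c i) w"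
    using insert assms(2,4) ai ci by (subst lincomb_smult) auto
  also have "\<dots> = lincomb M J (\<lambda>j. c i \<otimes> a i j \<oplus> (\<Oplus>i\<in>I. a i j \<otimes> c i)) w"
    using assms(4) ai ci s by (intro lincomb_add[symmetric]) auto
  also have "\<dots> = lincomb M J (\<lambda>j. \<Oplus>i\<in>insert i I. a i j \<otimes> c i) w"
  proof (rule lincomb_cong)
    fix j assume j: "j \<in> J"
    have "(\<Oplus>i\<in>insert i I. a i j \<otimes> c i) = a i j \<otimes> c i \<oplus> (\<Oplus>i\<in>I. a i j \<otimes> c i)"
      using insert j by (intro R.finsum_insert) auto
    also have "a i j \<otimes> c i = c i \<otimes> a i j" using ai ci j by (intro R.m_comm) auto
    finally show "(c i \<otimes> a i j \<oplus> (\<Oplus>i\<in>I. a i j \<otimes> c i)) \<odot>\<^bsub>M\<^esub> w j = (\<Oplus>i\<in>insert i I. a i j \<otimes> c i) \<odot>\<^bsub>M\<^esub> w j"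
      by simp
  next
    show "(\<lambda>j. \<Oplus>i\<in>insert i I. a i j \<otimes> c i) \<in> J \<rightarrow> carrier R"
      using insert by (auto intro!: R.finsum_closed)
  qed (fact assms(4))
  finally show ?case .
qed

text \<open>A relation among the \<open>v i\<close> is found by asking that all coordinates with
  respect to \<open>w\<close> vanish, which is one linear equation for each \<open>j\<close>. The
  family \<open>w\<close> may itself be dependent.\<close>

lemma dependent_if_card_less:
  assumes "field R" "finite I" "finite J" "card J < card I" "w \<in> J \<rightarrow> carrier M"
    and a: "\<And>i j. i \<in> I \<Longrightarrow> j \<in> J \<Longrightarrow> a i j \<in> carrier R"
    and v: "\<And>i. i \<in> I \<Longrightarrow> v i = lincomb M J (a i) w"
  shows "\<exists>c\<in>I \<rightarrow> carrier R. (\<exists>i\<in>I. c i \<noteq> \<zero>) \<and> lincomb M I c v = \<zero>\<^bsub>M\<^esub>"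
proof -
  have "\<exists>c\<in>I \<rightarrow> carrier R. (\<exists>i\<in>I. c i \<noteq> \<zero>) \<and> (\<forall>j\<in>J. (\<Oplus>i\<in>I. a i j \<otimes> c i) = \<zero>)"
    by (rule field.exists_nontrivial_solution[OF assms(1,3,2,4) a])
  then obtain c where c: "c \<in> I \<rightarrow> carrier R"
      "(\<exists>i\<in>I. c i \<noteq> \<zero>) \<and> (\<forall>j\<in>J. (\<Oplus>i\<in>I. a i j \<otimes> c i) = \<zero>)"
    by (rule bexE)
  have "lincomb M I c v = lincomb M I c (\<lambda>i. lincomb M J (a i) w)"
    using c(1) a assms(5) v by (intro lincomb_cong) (auto intro!: lincomb_closed)
  also have "\<dots> = lincomb M J (\<lambda>j. \<Oplus>i\<in>I. a i j \<otimes> c i) w"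
    using assms c(1) by (intro lincomb_lincomb) auto
  also have "\<dots> = \<zero>\<^bsub>M\<^esub>"
    unfolding lincomb_def using conjunct2[OF c(2)] assms(5) by (intro M.add.finprod_one_eqI) (simp add: Pi_iff)
  finally show ?thesis using c by blast
qed

end

section \<open>Module homomorphisms and finite sums\<close>

lemma mod_hom_zero:
  assumes "module R M" "module R N" "f \<in> mod_hom R M N"
  shows "f \<zero>\<^bsub>M\<^esub> = \<zero>\<^bsub>N\<^esub>"
proof -
  interpret M: module R M by fact
  interpret N: module R N by fact
  have "f (\<zero>\<^bsub>R\<^esub> \<odot>\<^bsub>M\<^esub> \<zero>\<^bsub>M\<^esub>) = \<zero>\<^bsub>R\<^esub> \<odot>\<^bsub>N\<^esub> f \<zero>\<^bsub>M\<^esub>" "f \<zero>\<^bsub>M\<^esub> \<in> carrier N"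
    using assms(3) unfolding mod_hom_def by blast+
  then show ?thesis by simp
qed

lemma mod_hom_finsum:
  assumes "module R M" "module R N" "f \<in> mod_hom R M N" "finite I" "x \<in> I \<rightarrow> carrier M"
  shows "f (\<Oplus>\<^bsub>M\<^esub>i\<in>I. x i) = (\<Oplus>\<^bsub>N\<^esub>i\<in>I. f (x i))"
proof -
  interpret M: module R M by fact
  interpret N: module R N by fact
  have f: "f (x \<oplus>\<^bsub>M\<^esub> y) = f x \<oplus>\<^bsub>N\<^esub> f y" "f x \<in> carrier N"
    if "x \<in> carrier M" "y \<in> carrier M" for x y
    using assms(3) that by (auto simp: mod_hom_def)
  show ?thesis using assms(4,5)
  proof (induction I)
    case empty
    show ?case by (simp add: mod_hom_zero[OF assms(1-3)])
  next
    case (insert i I)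
    have "(\<lambda>i. f (x i)) \<in> I \<rightarrow> carrier N" "f (x i) \<in> carrier N" "x \<in> I \<rightarrow> carrier M" "x i \<in> carrier M"
      using insert.prems f(2) by auto
    then show ?case using insert f(1) by (simp add: M.M.finsum_closed)
  qed
qed

lemma mod_hom_lincomb:
  assumes "module R M" "module R N" "f \<in> mod_hom R M N" "finite I"
    and "c \<in> I \<rightarrow> carrier R" "b \<in> I \<rightarrow> carrier M"
  shows "f (lincomb M I c b) = lincomb N I c (f \<circ> b)"
proof -
  interpret M: module R M by fact
  interpret N: module R N by fact
  have "f (lincomb M I c b) = (\<Oplus>\<^bsub>N\<^esub>i\<in>I. f (c i \<odot>\<^bsub>M\<^esub> b i))"
    unfolding lincomb_def using assms by (intro mod_hom_finsum) auto
  also have "\<dots> = lincomb N I c (f \<circ> b)"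
    unfolding lincomb_def using assms by (intro N.M.finsum_cong') (auto simp: mod_hom_def Pi_iff)
  finally show ?thesis .
qed

section \<open>Homogeneous components\<close>

locale graded_space = F?: field F + graded_module \<Gamma> F "trivial_grading \<Gamma> F" M
  for \<Gamma> :: "('g, 'd) monoid_scheme" and F :: "('a, 'b) ring_scheme"
    and M :: "('a, 'm, 'g) gr_module"

definition decomposes ::
    "('g, 'd) monoid_scheme \<Rightarrow> ('a, 'm, 'g) gr_module \<Rightarrow> 'm \<Rightarrow> ('g \<Rightarrow> 'm) \<Rightarrow> bool" where
  "decomposes \<Gamma> M x c \<longleftrightarrow> c \<in> (\<Pi> i\<in>carrier \<Gamma>. component M i) \<and>
     finite {i\<in>carrier \<Gamma>. c i \<noteq> \<zero>\<^bsub>M\<^esub>} \<and> x = (\<Oplus>\<^bsub>M\<^esub>i\<in>{i\<in>carrier \<Gamma>. c i \<noteq> \<zero>\<^bsub>M\<^esub>}. c i)"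

text \<open>The projection onto the component of degree \<open>\<gamma>\<close>. By
  \<open>decomposes_unique\<close> the choice of the decomposition does not affect the value when
  \<open>x\<close> is in the module and \<open>\<gamma>\<close> in the group.\<close>

definition part ::
    "('g, 'd) monoid_scheme \<Rightarrow> ('a, 'm, 'g) gr_module \<Rightarrow> 'g \<Rightarrow> 'm \<Rightarrow> 'm" where
  "part \<Gamma> M \<gamma> x = (SOME c. decomposes \<Gamma> M x c) \<gamma>"

context graded_space
begin

lemma component_additive_subgroup: "\<gamma> \<in> carrier \<Gamma> \<Longrightarrow> additive_subgroup (component M \<gamma>) M"
  using module_decomposition by (simp add: internal_direct_sum_def)

lemma component_subset: "\<gamma> \<in> carrier \<Gamma> \<Longrightarrow> component M \<gamma> \<subseteq> carrier M"
  using additive_subgroup.a_subset[OF component_additive_subgroup] .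

lemma component_zero: "\<gamma> \<in> carrier \<Gamma> \<Longrightarrow> \<zero>\<^bsub>M\<^esub> \<in> component M \<gamma>"
  using additive_subgroup.zero_closed[OF component_additive_subgroup] .

lemma component_add:
  "\<lbrakk>\<gamma> \<in> carrier \<Gamma>; x \<in> component M \<gamma>; y \<in> component M \<gamma>\<rbrakk> \<Longrightarrow> x \<oplus>\<^bsub>M\<^esub> y \<in> component M \<gamma>"
  using additive_subgroup.a_closed[OF component_additive_subgroup] .

text \<open>This is where the trivial grading enters: scalars have degree \<open>\<one>\<close>, so
  the components are subspaces.\<close>

lemma component_smult:
  assumes "\<gamma> \<in> carrier \<Gamma>" "a \<in> carrier F" "x \<in> component M \<gamma>"
  shows "a \<odot>\<^bsub>M\<^esub> x \<in> component M \<gamma>"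
  using graded_smult[of "\<one>\<^bsub>\<Gamma>\<^esub>" \<gamma> a x] assms by (simp add: trivial_grading_def)

lemma decomposes_exists:
  assumes "x \<in> carrier M" shows "\<exists>c. decomposes \<Gamma> M x c"
proof -
  have "\<exists>!c. c \<in> (\<Pi>\<^sub>E i\<in>carrier \<Gamma>. component M i) \<and> finite {i\<in>carrier \<Gamma>. c i \<noteq> \<zero>\<^bsub>M\<^esub>} \<and>
        x = (\<Oplus>\<^bsub>M\<^esub>i\<in>{i\<in>carrier \<Gamma>. c i \<noteq> \<zero>\<^bsub>M\<^esub>}. c i)"
    using module_decomposition assms unfolding internal_direct_sum_def by blast
  then show ?thesis
    unfolding decomposes_def PiE_def by blast
qed

lemma decomposes_restrict:
  assumes "decomposes \<Gamma> M x c"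
  shows "restrict c (carrier \<Gamma>) \<in> (\<Pi>\<^sub>E i\<in>carrier \<Gamma>. component M i) \<and>
    finite {i\<in>carrier \<Gamma>. restrict c (carrier \<Gamma>) i \<noteq> \<zero>\<^bsub>M\<^esub>} \<and>
    x = (\<Oplus>\<^bsub>M\<^esub>i\<in>{i\<in>carrier \<Gamma>. restrict c (carrier \<Gamma>) i \<noteq> \<zero>\<^bsub>M\<^esub>}. restrict c (carrier \<Gamma>) i)"
proof -
  have S: "{i\<in>carrier \<Gamma>. restrict c (carrier \<Gamma>) i \<noteq> \<zero>\<^bsub>M\<^esub>} = {i\<in>carrier \<Gamma>. c i \<noteq> \<zero>\<^bsub>M\<^esub>}"
    by auto
  have "(\<Oplus>\<^bsub>M\<^esub>i\<in>{i\<in>carrier \<Gamma>. c i \<noteq> \<zero>\<^bsub>M\<^esub>}. restrict c (carrier \<Gamma>) i)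
      = (\<Oplus>\<^bsub>M\<^esub>i\<in>{i\<in>carrier \<Gamma>. c i \<noteq> \<zero>\<^bsub>M\<^esub>}. c i)"
    using assms component_subset unfolding decomposes_def by (intro M.finsum_cong') (auto simp: Pi_iff)
  then show ?thesis
    using assms unfolding S decomposes_def by (simp add: Pi_iff)
qed

lemma decomposes_unique:
  assumes "x \<in> carrier M" "decomposes \<Gamma> M x c" "decomposes \<Gamma> M x c'" "\<gamma> \<in> carrier \<Gamma>"
  shows "c \<gamma> = c' \<gamma>"
proof -
  define P where "P = (\<lambda>c. c \<in> (\<Pi>\<^sub>E i\<in>carrier \<Gamma>. component M i) \<and>
    finite {i\<in>carrier \<Gamma>. c i \<noteq> \<zero>\<^bsub>M\<^esub>} \<and> x = (\<Oplus>\<^bsub>M\<^esub>i\<in>{i\<in>carrier \<Gamma>. c i \<noteq> \<zero>\<^bsub>M\<^esub>}. c i))"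
  have "\<exists>!c. P c"
    using module_decomposition assms(1) unfolding internal_direct_sum_def P_def by blast
  moreover have "P (restrict c (carrier \<Gamma>))" "P (restrict c' (carrier \<Gamma>))"
    unfolding P_def by (fact decomposes_restrict[OF assms(2)], fact decomposes_restrict[OF assms(3)])
  ultimately have "restrict c (carrier \<Gamma>) = restrict c' (carrier \<Gamma>)" by blast
  then show ?thesis using assms(4) by (metis restrict_apply')
qed

text \<open>The tool for computing projections: any way of writing an element as a finite sum of
  homogeneous terms of distinct degrees shows its parts, even if some terms are zero.\<close>

lemma part_eq:
  assumes "finite S" "S \<subseteq> carrier \<Gamma>" "\<And>i. i \<in> S \<Longrightarrow> c i \<in> component M i"
    and "\<gamma> \<in> carrier \<Gamma>"
  shows "part \<Gamma> M \<gamma> (\<Oplus>\<^bsub>M\<^esub>i\<in>S. c i) = (if \<gamma> \<in> S then c \<gamma> else \<zero>\<^bsub>M\<^esub>)"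
proof -
  let ?c = "\<lambda>i. if i \<in> S then c i else \<zero>\<^bsub>M\<^esub>"
  let ?x = "\<Oplus>\<^bsub>M\<^esub>i\<in>S. c i"
  let ?S = "{i\<in>carrier \<Gamma>. ?c i \<noteq> \<zero>\<^bsub>M\<^esub>}"
  have cM: "c i \<in> carrier M" if "i \<in> S" for i using assms(2,3) component_subset that by blast
  have sub: "?S \<subseteq> S" by auto
  \<comment> \<open>\<open>decomposes\<close> sums over the exact support, so the zero terms of
    \<open>S\<close> are dropped first.\<close>
  have "?x = (\<Oplus>\<^bsub>M\<^esub>i\<in>?S. ?c i)"
    using cM assms(1,2) sub by (intro M.add.finprod_mono_neutral_cong_right) (auto split: if_splits)
  then have dec: "decomposes \<Gamma> M ?x ?c"
    using assms component_zero finite_subset[OF sub] unfolding decomposes_def by auto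
  have x: "?x \<in> carrier M" using cM by (intro M.finsum_closed) auto
  have "part \<Gamma> M \<gamma> ?x = ?c \<gamma>"
    unfolding part_def by (rule decomposes_unique[OF x someI[of "decomposes \<Gamma> M ?x", OF dec] dec assms(4)])
  then show ?thesis .
qed

lemma part_in_component:
  assumes "x \<in> carrier M" "\<gamma> \<in> carrier \<Gamma>" shows "part \<Gamma> M \<gamma> x \<in> component M \<gamma>"
proof -
  have "decomposes \<Gamma> M x (\<lambda>\<gamma>. part \<Gamma> M \<gamma> x)"
    using someI_ex[OF decomposes_exists[OF assms(1)]] by (simp add: part_def)
  then show ?thesis using assms(2) by (auto simp: decomposes_def)
qed

lemma part_closed [intro]:
  "\<lbrakk>x \<in> carrier M; \<gamma> \<in> carrier \<Gamma>\<rbrakk> \<Longrightarrow> part \<Gamma> M \<gamma> x \<in> carrier M"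
  using part_in_component component_subset by blast

lemma finsum_part:
  assumes "x \<in> carrier M"
  obtains S where "finite S" "S \<subseteq> carrier \<Gamma>"
    "\<And>T. \<lbrakk>finite T; S \<subseteq> T; T \<subseteq> carrier \<Gamma>\<rbrakk> \<Longrightarrow> (\<Oplus>\<^bsub>M\<^esub>i\<in>T. part \<Gamma> M i x) = x"
proof
  let ?S = "{i\<in>carrier \<Gamma>. part \<Gamma> M i x \<noteq> \<zero>\<^bsub>M\<^esub>}"
  have dec: "decomposes \<Gamma> M x (\<lambda>\<gamma>. part \<Gamma> M \<gamma> x)"
    using someI_ex[OF decomposes_exists[OF assms(1)]] by (simp add: part_def)
  then show "finite ?S" "?S \<subseteq> carrier \<Gamma>" by (auto simp: decomposes_def)
  fix T assume T: "finite T" "?S \<subseteq> T" "T \<subseteq> carrier \<Gamma>"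
  have "(\<Oplus>\<^bsub>M\<^esub>i\<in>T. part \<Gamma> M i x) = (\<Oplus>\<^bsub>M\<^esub>i\<in>?S. part \<Gamma> M i x)"
    using T assms by (intro M.add.finprod_mono_neutral_cong_right) auto
  also have "\<dots> = x" using dec by (simp add: decomposes_def)
  finally show "(\<Oplus>\<^bsub>M\<^esub>i\<in>T. part \<Gamma> M i x) = x" .
qed

lemma part_homogeneous:
  assumes "x \<in> component M \<delta>" "\<delta> \<in> carrier \<Gamma>" "\<gamma> \<in> carrier \<Gamma>"
  shows "part \<Gamma> M \<gamma> x = (if \<gamma> = \<delta> then x else \<zero>\<^bsub>M\<^esub>)"
proof -
  have x: "x \<in> carrier M" using assms component_subset by blast
  show ?thesis
    using part_eq[of "{\<delta>}" "\<lambda>_. x" \<gamma>] assms x by simp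
qed

lemma part_mod_hom:
  assumes \<gamma>: "\<gamma> \<in> carrier \<Gamma>" shows "part \<Gamma> M \<gamma> \<in> mod_hom F M M"
proof -
  have add: "part \<Gamma> M \<gamma> (x \<oplus>\<^bsub>M\<^esub> y) = part \<Gamma> M \<gamma> x \<oplus>\<^bsub>M\<^esub> part \<Gamma> M \<gamma> y"
    if xy: "x \<in> carrier M" "y \<in> carrier M" for x y
  proof -
    obtain S where S: "finite S" "S \<subseteq> carrier \<Gamma>"
      "\<And>T. \<lbrakk>finite T; S \<subseteq> T; T \<subseteq> carrier \<Gamma>\<rbrakk> \<Longrightarrow> (\<Oplus>\<^bsub>M\<^esub>i\<in>T. part \<Gamma> M i x) = x"
      using finsum_part[OF xy(1)] by blast
    obtain S' where S': "finite S'" "S' \<subseteq> carrier \<Gamma>"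
      "\<And>T. \<lbrakk>finite T; S' \<subseteq> T; T \<subseteq> carrier \<Gamma>\<rbrakk> \<Longrightarrow> (\<Oplus>\<^bsub>M\<^esub>i\<in>T. part \<Gamma> M i y) = y"
      using finsum_part[OF xy(2)] by blast
    \<comment> \<open>A common set of degrees for both elements; with \<open>\<gamma>\<close>
      included, \<open>part_eq\<close> returns the term at \<open>\<gamma>\<close> and not its
      default zero.\<close>
    define T where "T = insert \<gamma> (S \<union> S')"
    have T: "finite T" "S \<subseteq> T" "S' \<subseteq> T" "T \<subseteq> carrier \<Gamma>" "\<gamma> \<in> T"
      using S S' \<gamma> by (auto simp: T_def)
    have "x \<oplus>\<^bsub>M\<^esub> y = (\<Oplus>\<^bsub>M\<^esub>i\<in>T. part \<Gamma> M i x) \<oplus>\<^bsub>M\<^esub> (\<Oplus>\<^bsub>M\<^esub>i\<in>T. part \<Gamma> M i y)"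
      using S(3) S'(3) T by simp
    also have "\<dots> = (\<Oplus>\<^bsub>M\<^esub>i\<in>T. part \<Gamma> M i x \<oplus>\<^bsub>M\<^esub> part \<Gamma> M i y)"
      using T xy by (intro M.finsum_addf[symmetric]) auto
    finally show ?thesis
      using part_eq[OF T(1,4), of "\<lambda>i. part \<Gamma> M i x \<oplus>\<^bsub>M\<^esub> part \<Gamma> M i y" \<gamma>] T(4,5) xy \<gamma>
      by (auto simp: subset_iff intro!: component_add part_in_component)
  qed
  have smult: "part \<Gamma> M \<gamma> (a \<odot>\<^bsub>M\<^esub> x) = a \<odot>\<^bsub>M\<^esub> part \<Gamma> M \<gamma> x"
    if ax: "a \<in> carrier F" "x \<in> carrier M" for a x
  proof -
    obtain S where S: "finite S" "S \<subseteq> carrier \<Gamma>"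
      "\<And>T. \<lbrakk>finite T; S \<subseteq> T; T \<subseteq> carrier \<Gamma>\<rbrakk> \<Longrightarrow> (\<Oplus>\<^bsub>M\<^esub>i\<in>T. part \<Gamma> M i x) = x"
      using finsum_part[OF ax(2)] by blast
    define T where "T = insert \<gamma> S"
    have T: "finite T" "S \<subseteq> T" "T \<subseteq> carrier \<Gamma>" "\<gamma> \<in> T"
      using S \<gamma> by (auto simp: T_def)
    have "a \<odot>\<^bsub>M\<^esub> x = a \<odot>\<^bsub>M\<^esub> (\<Oplus>\<^bsub>M\<^esub>i\<in>T. part \<Gamma> M i x)"
      using S(3) T by simp
    also have "\<dots> = (\<Oplus>\<^bsub>M\<^esub>i\<in>T. a \<odot>\<^bsub>M\<^esub> part \<Gamma> M i x)"
      using T ax by (intro finsum_smult_ldistr) auto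
    finally show ?thesis
      using part_eq[OF T(1,3), of "\<lambda>i. a \<odot>\<^bsub>M\<^esub> part \<Gamma> M i x" \<gamma>] T(3,4) ax \<gamma>
      by (auto simp: subset_iff intro!: component_smult part_in_component)
  qed
  show ?thesis using add smult \<gamma> by (auto simp: mod_hom_def)
qed

end

text \<open>The image of a homogeneous decomposition of \<open>x\<close> is one of
  \<open>f x\<close>. This later makes inverses degree-preserving and yields homogeneous
  preimages.\<close>

lemma part_gr_hom:
  assumes "graded_space \<Gamma> F M" "graded_space \<Gamma> F N" "f \<in> gr_hom \<Gamma> F M N"
    and "x \<in> carrier M" "\<gamma> \<in> carrier \<Gamma>"
  shows "part \<Gamma> N \<gamma> (f x) = f (part \<Gamma> M \<gamma> x)"
proof -
  interpret M: graded_space \<Gamma> F M by fact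
  interpret N: graded_space \<Gamma> F N by fact
  obtain S where S: "finite S" "S \<subseteq> carrier \<Gamma>"
    "\<And>T. \<lbrakk>finite T; S \<subseteq> T; T \<subseteq> carrier \<Gamma>\<rbrakk> \<Longrightarrow> (\<Oplus>\<^bsub>M\<^esub>i\<in>T. part \<Gamma> M i x) = x"
    using M.finsum_part[OF assms(4)] by blast
  define T where "T = insert \<gamma> S"
  have T: "finite T" "S \<subseteq> T" "T \<subseteq> carrier \<Gamma>" "\<gamma> \<in> T"
    using S assms(5) by (auto simp: T_def)
  have f: "f \<in> mod_hom F M N" "\<And>i y. \<lbrakk>i \<in> carrier \<Gamma>; y \<in> component M i\<rbrakk> \<Longrightarrow> f y \<in> component N i"
    using assms(3) by (auto simp: gr_hom_def)
  have "f x = f (\<Oplus>\<^bsub>M\<^esub>i\<in>T. part \<Gamma> M i x)" using S(3) T by simp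
  also have "\<dots> = (\<Oplus>\<^bsub>N\<^esub>i\<in>T. f (part \<Gamma> M i x))"
    using T assms(4) by (intro mod_hom_finsum[OF M.module_axioms N.module_axioms f(1)]) auto
  finally show ?thesis
    using N.part_eq[OF T(1,3), of "\<lambda>i. f (part \<Gamma> M i x)" \<gamma>] T(3,4) assms(4,5)
    by (auto simp: subset_iff intro!: f(2) M.part_in_component)
qed

section \<open>Homogeneous bases\<close>

definition spanning ::
    "('a, 'b) ring_scheme \<Rightarrow> ('a, 'm, 'z) module_scheme \<Rightarrow> 'i set \<Rightarrow> ('i \<Rightarrow> 'm) \<Rightarrow> bool" where
  "spanning R M I b \<longleftrightarrow> (\<forall>x\<in>carrier M. \<exists>c\<in>I \<rightarrow> carrier R. x = lincomb M I c b)"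

definition lin_independent ::
    "('a, 'b) ring_scheme \<Rightarrow> ('a, 'm, 'z) module_scheme \<Rightarrow> 'i set \<Rightarrow> ('i \<Rightarrow> 'm) \<Rightarrow> bool" where
  "lin_independent R M I b \<longleftrightarrow>
     (\<forall>c\<in>I \<rightarrow> carrier R. lincomb M I c b = \<zero>\<^bsub>M\<^esub> \<longrightarrow> (\<forall>i\<in>I. c i = \<zero>\<^bsub>R\<^esub>))"

text \<open>The degrees are part of the data, since a zero vector, which a spanning family may
  contain, lies in every component.\<close>

definition homogeneous ::
    "('g, 'd) monoid_scheme \<Rightarrow> ('a, 'm, 'g) gr_module \<Rightarrow> 'i set \<Rightarrow> ('i \<Rightarrow> 'm) \<Rightarrow> ('i \<Rightarrow> 'g) \<Rightarrow> bool" where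
  "homogeneous \<Gamma> M I b d \<longleftrightarrow> (\<forall>i\<in>I. d i \<in> carrier \<Gamma> \<and> b i \<in> component M (d i))"

definition homogeneous_basis ::
    "('g, 'd) monoid_scheme \<Rightarrow> ('a, 'b) ring_scheme \<Rightarrow> ('a, 'm, 'g) gr_module
      \<Rightarrow> 'i set \<Rightarrow> ('i \<Rightarrow> 'm) \<Rightarrow> ('i \<Rightarrow> 'g) \<Rightarrow> bool" where
  "homogeneous_basis \<Gamma> F M I b d \<longleftrightarrow>
     finite I \<and> homogeneous \<Gamma> M I b d \<and> spanning F M I b \<and> lin_independent F M I b"

text \<open>Applied both to the span of a family and to a homogeneous component. For an infinite
  index set the sum is \<open>\<zero>\<close> by convention.\<close>

lemma (in abelian_monoid) finsum_in_subset:
  assumes "L \<subseteq> carrier G" "\<zero> \<in> L" "\<And>x y. x \<in> L \<Longrightarrow> y \<in> L \<Longrightarrow> x \<oplus> y \<in> L" "x \<in> A \<rightarrow> L"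
  shows "finsum G x A \<in> L"
  using assms(4)
proof (induction A rule: infinite_finite_induct)
  case (insert i A)
  have "x \<in> A \<rightarrow> carrier G" "x i \<in> carrier G" using insert.prems assms(1) by auto
  then show ?case using insert assms(3) by auto
qed (use assms(2) finsum_infinite in auto)

lemma lookup_sum_frag_of:
  assumes "finite I"
  shows "Poly_Mapping.lookup (\<Sum>i\<in>I. frag_of (d i)) \<gamma> = int (card {i\<in>I. d i = \<gamma>})"
proof -
  have "Poly_Mapping.lookup (\<Sum>i\<in>I. frag_of (d i)) \<gamma> = (\<Sum>i\<in>I. if d i = \<gamma> then 1 else 0)"
    by (auto simp: lookup_sum intro!: sum.cong)
  also have "\<dots> = int (card {i\<in>I. d i = \<gamma>})"
    using assms by (simp add: sum.If_cases Int_def conj_commute)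
  finally show ?thesis .
qed

context graded_space
begin

lemma homogeneous_closed: "homogeneous \<Gamma> M I b d \<Longrightarrow> b \<in> I \<rightarrow> carrier M"
  using component_subset by (auto simp: homogeneous_def)

section \<open>Uniqueness of the degrees of a homogeneous basis\<close>

text \<open>Projecting to degree \<open>d i\<close> sends the combination to zero, because it is
  homogeneous of another degree, but keeps its terms of degree \<open>d i\<close>. Independence then
  makes their coefficients vanish.\<close>

lemma homogeneous_basis_coordinate_zero:
  assumes B: "homogeneous_basis \<Gamma> F M I b d" and c: "c \<in> I \<rightarrow> carrier F"
    and x: "lincomb M I c b \<in> component M \<gamma>" and \<gamma>: "\<gamma> \<in> carrier \<Gamma>"
    and i: "i \<in> I" "d i \<noteq> \<gamma>"
  shows "c i = \<zero>\<^bsub>F\<^esub>"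
proof -
  have I: "finite I" and hom: "homogeneous \<Gamma> M I b d" and ind: "lin_independent F M I b"
    using B by (auto simp: homogeneous_basis_def)
  have b: "b \<in> I \<rightarrow> carrier M" by (rule homogeneous_closed[OF hom])
  have di: "d i \<in> carrier \<Gamma>" using hom i by (auto simp: homogeneous_def)
  let ?c = "\<lambda>j. if d j = d i then c j else \<zero>\<^bsub>F\<^esub>"
  have "lincomb M I ?c b = lincomb M I c (part \<Gamma> M (d i) \<circ> b)"
  proof (rule lincomb_cong)
    fix j assume j: "j \<in> I"
    then have "b j \<in> component M (d j)" "d j \<in> carrier \<Gamma>" using hom by (auto simp: homogeneous_def)
    then have "part \<Gamma> M (d i) (b j) = (if d i = d j then b j else \<zero>\<^bsub>M\<^esub>)"
      using di by (intro part_homogeneous)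
    then show "?c j \<odot>\<^bsub>M\<^esub> b j = c j \<odot>\<^bsub>M\<^esub> (part \<Gamma> M (d i) \<circ> b) j"
      using b c j by (auto simp: Pi_iff)
  qed (use c b di in \<open>auto intro!: part_closed\<close>)
  also have "\<dots> = part \<Gamma> M (d i) (lincomb M I c b)"
    using mod_hom_lincomb[OF module_axioms module_axioms part_mod_hom[OF di] I c b] ..
  also have "\<dots> = \<zero>\<^bsub>M\<^esub>" using part_homogeneous[OF x \<gamma> di] i by simp
  finally have z: "lincomb M I ?c b = \<zero>\<^bsub>M\<^esub>" .
  have "?c \<in> I \<rightarrow> carrier F" using c by auto
  then have "\<forall>j\<in>I. ?c j = \<zero>\<^bsub>F\<^esub>"
    by (rule mp[OF bspec[OF ind[unfolded lin_independent_def]] z])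
  then show ?thesis using i(1) by auto
qed

text \<open>By the previous lemma, the members of \<open>b\<close> of degree \<open>\<gamma>\<close>
  are combinations of those members of \<open>w\<close> that have degree \<open>\<gamma>\<close>. If
  there were more of the former, they would be dependent.\<close>

lemma homogeneous_basis_card_le:
  assumes B: "homogeneous_basis \<Gamma> F M I b d" and B': "homogeneous_basis \<Gamma> F M J w e"
    and \<gamma>: "\<gamma> \<in> carrier \<Gamma>"
  shows "card {i\<in>I. d i = \<gamma>} \<le> card {j\<in>J. e j = \<gamma>}"
proof (rule ccontr)
  let ?I = "{i\<in>I. d i = \<gamma>}" and ?J = "{j\<in>J. e j = \<gamma>}"
  assume "\<not> ?thesis"
  then have less: "card ?J < card ?I" by simp
  have I: "finite I" and hom: "homogeneous \<Gamma> M I b d" and ind: "lin_independent F M I b"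
    using B by (auto simp: homogeneous_basis_def)
  have J: "finite J" and hom': "homogeneous \<Gamma> M J w e" and span: "spanning F M J w"
    using B' by (auto simp: homogeneous_basis_def)
  have b: "b \<in> I \<rightarrow> carrier M" and w: "w \<in> J \<rightarrow> carrier M"
    using homogeneous_closed hom hom' by auto
  have "\<exists>a\<in>J \<rightarrow> carrier F. b i = lincomb M J a w" if "i \<in> I" for i
    using span b that by (auto simp: spanning_def)
  then obtain a where a: "\<And>i. i \<in> I \<Longrightarrow> a i \<in> J \<rightarrow> carrier F"
      "\<And>i. i \<in> I \<Longrightarrow> b i = lincomb M J (a i) w"
    by metis
  have v: "b i = lincomb M ?J (a i) w" if i: "i \<in> ?I" for i
  proof -
    have "lincomb M J (a i) w \<in> component M \<gamma>"
      using i hom a(2)[of i] by (auto simp: homogeneous_def)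
    then have "lincomb M J (a i) w = lincomb M ?J (a i) w"
      using homogeneous_basis_coordinate_zero[OF B' a(1) _ \<gamma>] i J w a(1)[of i]
      by (intro lincomb_subset) auto
    then show ?thesis using a(2) i by simp
  qed
  have "\<exists>c\<in>?I \<rightarrow> carrier F. (\<exists>i\<in>?I. c i \<noteq> \<zero>\<^bsub>F\<^esub>) \<and> lincomb M ?I c b = \<zero>\<^bsub>M\<^esub>"
    using I J w a(1) v by (intro dependent_if_card_less[OF F.field_axioms _ _ less, of w a]) auto
  then obtain c where c: "c \<in> ?I \<rightarrow> carrier F" "\<exists>i\<in>?I. c i \<noteq> \<zero>\<^bsub>F\<^esub>" "lincomb M ?I c b = \<zero>\<^bsub>M\<^esub>"
    by blast
  \<comment> \<open>Extension by zero, since independence is known only for the whole family over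
    \<open>I\<close>.\<close>
  let ?c = "\<lambda>i. if d i = \<gamma> then c i else \<zero>\<^bsub>F\<^esub>"
  have c': "?c \<in> I \<rightarrow> carrier F" using c(1) by auto
  have "lincomb M I ?c b = lincomb M ?I ?c b"
    using I b c' by (intro lincomb_subset) auto
  also have "\<dots> = lincomb M ?I c b"
    using c(1) b by (intro lincomb_cong) auto
  finally have z: "lincomb M I ?c b = \<zero>\<^bsub>M\<^esub>" using c(3) by simp
  have "\<forall>i\<in>I. ?c i = \<zero>\<^bsub>F\<^esub>"
    by (rule mp[OF bspec[OF ind[unfolded lin_independent_def] c'] z])
  then show False using c(2) by auto
qed

text \<open>The two index types are unrelated, so a basis over \<open>nat + nat\<close> can be
  compared with one over \<open>nat\<close>.\<close>

lemma homogeneous_basis_degrees_unique: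
  assumes B: "homogeneous_basis \<Gamma> F M I b d" and B': "homogeneous_basis \<Gamma> F M J w e"
  shows "(\<Sum>i\<in>I. frag_of (d i)) = (\<Sum>j\<in>J. frag_of (e j))"
proof (rule poly_mapping_eqI)
  fix \<gamma>
  have fin: "finite I" "finite J" using B B' by (auto simp: homogeneous_basis_def)
  have "card {i\<in>I. d i = \<gamma>} = card {j\<in>J. e j = \<gamma>}"
  proof (cases "\<gamma> \<in> carrier \<Gamma>")
    case True
    show ?thesis
      using homogeneous_basis_card_le[OF B B' True] homogeneous_basis_card_le[OF B' B True] by simp
  next
    case False
    then have "{i\<in>I. d i = \<gamma>} = {}" "{j\<in>J. e j = \<gamma>} = {}"
      using B B' by (auto simp: homogeneous_basis_def homogeneous_def)
    then show ?thesis by (simp only: card.empty)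
  qed
  then show "Poly_Mapping.lookup (\<Sum>i\<in>I. frag_of (d i)) \<gamma> = Poly_Mapping.lookup (\<Sum>j\<in>J. frag_of (e j)) \<gamma>"
    by (simp add: lookup_sum_frag_of fin)
qed

section \<open>Existence of homogeneous bases\<close>

text \<open>Each of the finitely many generators is replaced by its homogeneous parts over a finite
  set of degrees.\<close>

lemma exists_homogeneous_spanning:
  assumes "finitely_generated F M"
  shows "\<exists>I::nat set. \<exists>b d. finite I \<and> homogeneous \<Gamma> M I b d \<and> spanning F M I b"
proof -
  obtain S where S: "finite S" "S \<subseteq> carrier M"
      "\<And>x. x \<in> carrier M \<Longrightarrow> \<exists>c\<in>S \<rightarrow> carrier F. x = (\<Oplus>\<^bsub>M\<^esub>y\<in>S. c y \<odot>\<^bsub>M\<^esub> y)"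
    using assms unfolding finitely_generated_def by blast
  have "\<exists>T. finite T \<and> T \<subseteq> carrier \<Gamma> \<and> (\<Oplus>\<^bsub>M\<^esub>i\<in>T. part \<Gamma> M i s) = s" if "s \<in> S" for s
    using finsum_part[of s] S(2) that by (metis subsetD subset_refl)
  then obtain T where T: "\<And>s. s \<in> S \<Longrightarrow> finite (T s)" "\<And>s. s \<in> S \<Longrightarrow> T s \<subseteq> carrier \<Gamma>"
      "\<And>s. s \<in> S \<Longrightarrow> (\<Oplus>\<^bsub>M\<^esub>i\<in>T s. part \<Gamma> M i s) = s"
    by metis
  define B where "B = (\<Union>s\<in>S. (\<lambda>i. part \<Gamma> M i s) ` T s)"
  have fin: "finite B" using S(1) T(1) by (auto simp: B_def)
  have hom: "\<exists>\<gamma>\<in>carrier \<Gamma>. y \<in> component M \<gamma>" if "y \<in> B" for y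
    using that S(2) T(2) by (force simp: B_def intro: part_in_component)
  have BM: "B \<subseteq> carrier M" using hom component_subset by blast
  obtain b :: "nat \<Rightarrow> 'm" where b: "bij_betw b {0..<card B} B"
    using ex_bij_betw_nat_finite[OF fin] by blast
  define I where "I = {0..<card B}"
  have bI: "b ` I = B" "inj_on b I" using b by (auto simp: bij_betw_def I_def)
  obtain deg where deg: "\<And>y. y \<in> B \<Longrightarrow> deg y \<in> carrier \<Gamma> \<and> y \<in> component M (deg y)"
    using hom by metis
  have homb: "homogeneous \<Gamma> M I b (deg \<circ> b)"
    using deg bI by (auto simp: homogeneous_def)
  have bM: "b \<in> I \<rightarrow> carrier M" using bI BM by auto
  \<comment> \<open>The span of the homogeneous parts. It contains each generator, as the sum of its
    parts, and is closed under combinations, hence it is everything.\<close>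
  define L where "L = {lincomb M I c b |c. c \<in> I \<rightarrow> carrier F}"
  have Lsmult: "a \<odot>\<^bsub>M\<^esub> x \<in> L" if "a \<in> carrier F" "x \<in> L" for a x
  proof -
    obtain c where c: "c \<in> I \<rightarrow> carrier F" "x = lincomb M I c b" using \<open>x \<in> L\<close> by (auto simp: L_def)
    have "a \<odot>\<^bsub>M\<^esub> x = lincomb M I (\<lambda>i. a \<otimes>\<^bsub>F\<^esub> c i) b"
      using lincomb_smult[of I c a b] c bM that(1) by (simp add: I_def)
    moreover have "(\<lambda>i. a \<otimes>\<^bsub>F\<^esub> c i) \<in> I \<rightarrow> carrier F" using c(1) that(1) by auto
    ultimately show ?thesis unfolding L_def by blast
  qed
  have Ladd: "x \<oplus>\<^bsub>M\<^esub> y \<in> L" if xy: "x \<in> L" "y \<in> L" for x y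
  proof -
    obtain c where c: "c \<in> I \<rightarrow> carrier F" "x = lincomb M I c b"
      using xy(1) by (auto simp: L_def)
    obtain c' where c': "c' \<in> I \<rightarrow> carrier F" "y = lincomb M I c' b"
      using xy(2) by (auto simp: L_def)
    have "x \<oplus>\<^bsub>M\<^esub> y = lincomb M I (\<lambda>i. c i \<oplus>\<^bsub>F\<^esub> c' i) b"
      using lincomb_add[OF c(1) c'(1) bM] c(2) c'(2) by simp
    moreover have "(\<lambda>i. c i \<oplus>\<^bsub>F\<^esub> c' i) \<in> I \<rightarrow> carrier F" using c(1) c'(1) by auto
    ultimately show ?thesis unfolding L_def by blast
  qed
  have Lb: "b i \<in> L" if i: "i \<in> I" for i
  proof -
    have "b i = lincomb M I (\<lambda>j. if j = i then \<one>\<^bsub>F\<^esub> else \<zero>\<^bsub>F\<^esub>) b"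
      using lincomb_single[of I i b "\<one>\<^bsub>F\<^esub>"] i bM by (auto simp: I_def Pi_iff)
    moreover have "(\<lambda>j. if j = i then \<one>\<^bsub>F\<^esub> else \<zero>\<^bsub>F\<^esub>) \<in> I \<rightarrow> carrier F" by auto
    ultimately show ?thesis unfolding L_def by blast
  qed
  have L0: "\<zero>\<^bsub>M\<^esub> \<in> L"
  proof -
    have "lincomb M I (\<lambda>_. \<zero>\<^bsub>F\<^esub>) b = \<zero>\<^bsub>M\<^esub>"
      unfolding lincomb_def using bM by (intro M.add.finprod_one_eqI) (auto simp: Pi_iff)
    then show ?thesis unfolding L_def by (intro CollectI exI[of _ "\<lambda>_. \<zero>\<^bsub>F\<^esub>"]) auto
  qed
  have LM: "L \<subseteq> carrier M" using bM by (auto simp: L_def)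
  note Lsum = M.finsum_in_subset[OF LM L0 Ladd]
  have SL: "S \<subseteq> L"
  proof
    fix s assume s: "s \<in> S"
    have "B \<subseteq> L" using Lb bI(1) by auto
    moreover have "part \<Gamma> M i s \<in> B" if "i \<in> T s" for i
      using that s by (auto simp: B_def)
    ultimately have "(\<Oplus>\<^bsub>M\<^esub>i\<in>T s. part \<Gamma> M i s) \<in> L" by (intro Lsum) auto
    then show "s \<in> L" using T(3) s by simp
  qed
  have "spanning F M I b"
    unfolding spanning_def
  proof
    fix x assume "x \<in> carrier M"
    then obtain c where c: "c \<in> S \<rightarrow> carrier F" "x = (\<Oplus>\<^bsub>M\<^esub>y\<in>S. c y \<odot>\<^bsub>M\<^esub> y)" using S(3) by blast
    have "x \<in> L" unfolding c(2) using c(1) SL by (intro Lsum Pi_I Lsmult) auto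
    then show "\<exists>c\<in>I \<rightarrow> carrier F. x = lincomb M I c b" by (auto simp: L_def)
  qed
  moreover have "finite I" by (simp add: I_def)
  ultimately show ?thesis using homb by blast
qed

text \<open>A homogeneous spanning family of minimal cardinality is independent.\<close>

lemma exists_homogeneous_basis:
  assumes "finitely_generated F M"
  shows "\<exists>I::nat set. \<exists>b d. homogeneous_basis \<Gamma> F M I b d"
proof -
  define P where "P n \<longleftrightarrow> (\<exists>I::nat set. \<exists>b d. finite I \<and> card I = n \<and> homogeneous \<Gamma> M I b d
    \<and> spanning F M I b)" for n
  have "\<exists>n. P n" using exists_homogeneous_spanning[OF assms] unfolding P_def by blast
  then obtain n where n: "P n" "\<And>m. m < n \<Longrightarrow> \<not> P m"
    using exists_least_iff[of P] by blast
  then obtain I :: "nat set" and b d where I: "finite I" "card I = n" "homogeneous \<Gamma> M I b d"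
      "spanning F M I b"
    unfolding P_def by blast
  have b: "b \<in> I \<rightarrow> carrier M" by (rule homogeneous_closed[OF I(3)])
  have "lin_independent F M I b"
    unfolding lin_independent_def
  proof (intro ballI impI, rule ccontr)
    fix c k assume c: "c \<in> I \<rightarrow> carrier F" "lincomb M I c b = \<zero>\<^bsub>M\<^esub>" and k: "k \<in> I" "c k \<noteq> \<zero>\<^bsub>F\<^esub>"
    let ?I = "I - {k}"
    have ck: "c k \<in> Units F" using c(1) k by (auto simp: F.field_Units)
    have "\<exists>a\<in>?I \<rightarrow> carrier F. x = lincomb M ?I a b" if x: "x \<in> carrier M" for x
    proof -
      obtain a where a: "a \<in> I \<rightarrow> carrier F" "x = lincomb M I a b"
        using I(4) x unfolding spanning_def by blast
      have ak: "a k \<in> carrier F" using a(1) k by auto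
      define u where "u = a k \<otimes>\<^bsub>F\<^esub> inv\<^bsub>F\<^esub> c k"
      have u: "u \<in> carrier F" using ak ck by (simp add: u_def)
      define a' where "a' i = a i \<ominus>\<^bsub>F\<^esub> u \<otimes>\<^bsub>F\<^esub> c i" for i
      have a': "a' \<in> I \<rightarrow> carrier F" using a(1) c(1) u by (auto simp: a'_def Pi_iff intro!: F.minus_closed)
      have a'k: "a' k = \<zero>\<^bsub>F\<^esub>"
        using ck ak F.Units_closed[OF ck] by (simp add: a'_def u_def F.m_assoc F.minus_eq F.r_neg)
      have "lincomb M I a' b = lincomb M I a b \<ominus>\<^bsub>M\<^esub> lincomb M I (\<lambda>i. u \<otimes>\<^bsub>F\<^esub> c i) b"
        unfolding a'_def using I(1) a(1) c(1) u b by (intro lincomb_diff) auto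
      also have "\<dots> = x"
        using lincomb_smult[OF I(1) c(1) u b] c(2) u x a(2) by (simp add: M.minus_eq)
      finally have "x = lincomb M I a' b" ..
      also have "\<dots> = lincomb M ?I a' b"
        using I(1) a' b a'k by (intro lincomb_subset) auto
      finally show ?thesis using a' by blast
    qed
    then have "spanning F M ?I b" by (simp add: spanning_def)
    moreover have "homogeneous \<Gamma> M ?I b d" using I(3) by (simp add: homogeneous_def)
    ultimately have "P (card ?I)" using I(1) unfolding P_def by blast
    moreover have "card ?I < n" using I k by (metis card_Diff1_less)
    ultimately show False using n(2) by blast
  qed
  then show ?thesis using I unfolding homogeneous_basis_def by blast
qed

end

section \<open>Isomorphisms and exact sequences\<close>

lemma gr_homD:
  assumes "f \<in> gr_hom \<Gamma> R M N"
  shows "f \<in> mod_hom R M N" "f \<in> carrier M \<rightarrow> carrier N"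
    and "\<And>\<gamma> x. \<lbrakk>\<gamma> \<in> carrier \<Gamma>; x \<in> component M \<gamma>\<rbrakk> \<Longrightarrow> f x \<in> component N \<gamma>"
  using assms unfolding gr_hom_def mod_hom_def by blast+

lemma gr_isomorphic_refl: "gr_isomorphic \<Gamma> R M M"
proof -
  have "id \<in> gr_hom \<Gamma> R M M" by (auto simp: gr_hom_def mod_hom_def)
  then show ?thesis unfolding gr_isomorphic_def by (intro bexI[of _ id]) auto
qed

lemma gr_isomorphic_trans:
  assumes "gr_isomorphic \<Gamma> R L M" "gr_isomorphic \<Gamma> R M N"
  shows "gr_isomorphic \<Gamma> R L N"
proof -
  obtain f g where fg: "f \<in> gr_hom \<Gamma> R L M" "bij_betw f (carrier L) (carrier M)"
      "g \<in> gr_hom \<Gamma> R M N" "bij_betw g (carrier M) (carrier N)"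
    using assms by (auto simp: gr_isomorphic_def)
  have f: "f x \<in> carrier M" if "x \<in> carrier L" for x using gr_homD(2)[OF fg(1)] that by auto
  have "g \<circ> f \<in> gr_hom \<Gamma> R L N"
    using fg(1,3) f unfolding gr_hom_def mod_hom_def by (auto simp: Pi_iff image_subset_iff)
  then show ?thesis
    using bij_betw_trans[OF fg(2,4)] unfolding gr_isomorphic_def by blast
qed

text \<open>The point is that the inverse \<open>h\<close> preserves degrees: for \<open>y\<close>
  of degree \<open>\<gamma>\<close>, both \<open>h y\<close> and its part of degree
  \<open>\<gamma>\<close> are mapped to \<open>y\<close> by \<open>f\<close>, so they
  coincide.\<close>

lemma gr_isomorphic_sym:
  assumes M: "graded_space \<Gamma> F M" and N: "graded_space \<Gamma> F N" and "gr_isomorphic \<Gamma> F M N"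
  shows "gr_isomorphic \<Gamma> F N M"
proof -
  interpret M: graded_space \<Gamma> F M by fact
  interpret N: graded_space \<Gamma> F N by fact
  obtain f where f: "f \<in> gr_hom \<Gamma> F M N" "bij_betw f (carrier M) (carrier N)"
    using assms(3) by (auto simp: gr_isomorphic_def)
  define h where "h = inv_into (carrier M) f"
  have h: "h y \<in> carrier M" "f (h y) = y" if "y \<in> carrier N" for y
    using f(2) that unfolding h_def bij_betw_def by (auto intro: inv_into_into f_inv_into_f)
  have eq: "x = y" if "f x = f y" "x \<in> carrier M" "y \<in> carrier M" for x y
    using f(2) that by (auto simp: bij_betw_def inj_on_def)
  have f_add: "f (x \<oplus>\<^bsub>M\<^esub> y) = f x \<oplus>\<^bsub>N\<^esub> f y" if "x \<in> carrier M" "y \<in> carrier M" for x y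
    using gr_homD(1)[OF f(1)] that by (auto simp: mod_hom_def)
  have f_smult: "f (a \<odot>\<^bsub>M\<^esub> x) = a \<odot>\<^bsub>N\<^esub> f x" if "a \<in> carrier F" "x \<in> carrier M" for a x
    using gr_homD(1)[OF f(1)] that by (auto simp: mod_hom_def)
  have "h (x \<oplus>\<^bsub>N\<^esub> y) = h x \<oplus>\<^bsub>M\<^esub> h y" if "x \<in> carrier N" "y \<in> carrier N" for x y
    using h that by (intro eq) (auto simp: f_add)
  moreover have "h (a \<odot>\<^bsub>N\<^esub> x) = a \<odot>\<^bsub>M\<^esub> h x" if "a \<in> carrier F" "x \<in> carrier N" for a x
    using h that by (intro eq) (auto simp: f_smult)
  moreover have "h y \<in> component M \<gamma>" if "\<gamma> \<in> carrier \<Gamma>" "y \<in> component N \<gamma>" for \<gamma> y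
  proof -
    have y: "y \<in> carrier N" using that N.component_subset by blast
    have "f (part \<Gamma> M \<gamma> (h y)) = part \<Gamma> N \<gamma> (f (h y))"
      using part_gr_hom[OF M N f(1) h(1)[OF y] that(1)] ..
    also have "\<dots> = f (h y)"
      using N.part_homogeneous[OF that(2) that(1) that(1)] h(2)[OF y] by simp
    finally have "part \<Gamma> M \<gamma> (h y) = h y"
      using h(1)[OF y] that(1) by (intro eq) (auto intro: M.part_closed)
    then show ?thesis using M.part_in_component[OF h(1)[OF y] that(1)] by simp
  qed
  ultimately have "h \<in> gr_hom \<Gamma> F N M"
    using h(1) by (auto simp: gr_hom_def mod_hom_def)
  moreover have "bij_betw h (carrier N) (carrier M)"
    unfolding h_def using f(2) by (rule bij_betw_inv_into)
  ultimately show ?thesis unfolding gr_isomorphic_def by blast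
qed

lemma homogeneous_basis_iso:
  assumes M: "graded_space \<Gamma> F M" and N: "graded_space \<Gamma> F N"
    and f: "f \<in> gr_hom \<Gamma> F M N" "bij_betw f (carrier M) (carrier N)"
    and B: "homogeneous_basis \<Gamma> F M I b d"
  shows "homogeneous_basis \<Gamma> F N I (f \<circ> b) d"
proof -
  interpret M: graded_space \<Gamma> F M by fact
  interpret N: graded_space \<Gamma> F N by fact
  have I: "finite I" and hom: "homogeneous \<Gamma> M I b d" and span: "spanning F M I b"
    and ind: "lin_independent F M I b"
    using B by (auto simp: homogeneous_basis_def)
  have b: "b \<in> I \<rightarrow> carrier M" by (rule M.homogeneous_closed[OF hom])
  note flin = mod_hom_lincomb[OF M.module_axioms N.module_axioms gr_homD(1)[OF f(1)] I _ b]
  have "homogeneous \<Gamma> N I (f \<circ> b) d"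
    using hom gr_homD(3)[OF f(1)] by (auto simp: homogeneous_def)
  moreover have "spanning F N I (f \<circ> b)"
    unfolding spanning_def
  proof
    fix y assume "y \<in> carrier N"
    then obtain x where x: "x \<in> carrier M" "y = f x" using f(2) by (auto simp: bij_betw_def)
    then obtain c where "c \<in> I \<rightarrow> carrier F" "x = lincomb M I c b"
      using span unfolding spanning_def by blast
    then show "\<exists>c\<in>I \<rightarrow> carrier F. y = lincomb N I c (f \<circ> b)" using flin x by blast
  qed
  moreover have "lin_independent F N I (f \<circ> b)"
    unfolding lin_independent_def
  proof (intro ballI impI)
    fix c i assume c: "c \<in> I \<rightarrow> carrier F" "lincomb N I c (f \<circ> b) = \<zero>\<^bsub>N\<^esub>" and i: "i \<in> I"
    have "f (lincomb M I c b) = f \<zero>\<^bsub>M\<^esub>"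
      using flin c mod_hom_zero[OF M.module_axioms N.module_axioms gr_homD(1)[OF f(1)]] by simp
    then have "lincomb M I c b = \<zero>\<^bsub>M\<^esub>"
      using f(2) M.lincomb_closed[OF c(1) b] by (auto simp: bij_betw_def inj_on_def)
    then show "c i = \<zero>\<^bsub>F\<^esub>" using ind c(1) i unfolding lin_independent_def by blast
  qed
  ultimately show ?thesis using I by (simp add: homogeneous_basis_def)
qed

section \<open>Homogeneous bases in short exact sequences\<close>

text \<open>The basis consists of the images of \<open>b1\<close> and of lifts of \<open>b2\<close>.
  To make a lift homogeneous, an arbitrary preimage of \<open>b2 j\<close> is replaced by its part
  of degree \<open>d2 j\<close>; this is still a preimage because \<open>g\<close> commutes with the
  projections.\<close>

lemma homogeneous_basis_short_exact:
  assumes P1: "graded_space \<Gamma> F P1" and P: "graded_space \<Gamma> F P" and P2: "graded_space \<Gamma> F P2"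
    and ex: "short_exact \<Gamma> F P1 P P2"
    and B1: "homogeneous_basis \<Gamma> F P1 I b1 d1" and B2: "homogeneous_basis \<Gamma> F P2 J b2 d2"
  shows "\<exists>b. homogeneous_basis \<Gamma> F P (I <+> J) b (case_sum d1 d2)"
proof -
  interpret P1: graded_space \<Gamma> F P1 by fact
  interpret P: graded_space \<Gamma> F P by fact
  interpret P2: graded_space \<Gamma> F P2 by fact
  obtain f g where f: "f \<in> gr_hom \<Gamma> F P1 P" and g: "g \<in> gr_hom \<Gamma> F P P2"
      and inj: "inj_on f (carrier P1)"
      and ker: "f ` carrier P1 = {x \<in> carrier P. g x = \<zero>\<^bsub>P2\<^esub>}" and surj: "g ` carrier P = carrier P2"
    using ex by (auto simp: short_exact_def)
  note fm = gr_homD(1)[OF f] and gm = gr_homD(1)[OF g]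
  have I: "finite I" and hom1: "homogeneous \<Gamma> P1 I b1 d1" and span1: "spanning F P1 I b1"
    and ind1: "lin_independent F P1 I b1"
    using B1 by (auto simp: homogeneous_basis_def)
  have J: "finite J" and hom2: "homogeneous \<Gamma> P2 J b2 d2" and span2: "spanning F P2 J b2"
    and ind2: "lin_independent F P2 J b2"
    using B2 by (auto simp: homogeneous_basis_def)
  have b1: "b1 \<in> I \<rightarrow> carrier P1" by (rule P1.homogeneous_closed[OF hom1])
  have b2: "b2 \<in> J \<rightarrow> carrier P2" by (rule P2.homogeneous_closed[OF hom2])
  have lift: "\<exists>x\<in>component P (d2 j). g x = b2 j" if j: "j \<in> J" for j
  proof -
    have dj: "d2 j \<in> carrier \<Gamma>" "b2 j \<in> component P2 (d2 j)" using hom2 j by (auto simp: homogeneous_def)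
    have "b2 j \<in> g ` carrier P" using b2 j surj by auto
    then obtain x where x: "x \<in> carrier P" "b2 j = g x" by blast
    have "g (part \<Gamma> P (d2 j) x) = part \<Gamma> P2 (d2 j) (b2 j)"
      using part_gr_hom[OF P P2 g x(1) dj(1)] x(2) by simp
    also have "\<dots> = b2 j" using P2.part_homogeneous[OF dj(2,1,1)] by simp
    finally show ?thesis using P.part_in_component[OF x(1) dj(1)] by blast
  qed
  obtain l where l: "\<And>j. j \<in> J \<Longrightarrow> l j \<in> component P (d2 j)" "\<And>j. j \<in> J \<Longrightarrow> g (l j) = b2 j"
    using lift by metis
  have homf: "homogeneous \<Gamma> P I (f \<circ> b1) d1"
    using hom1 gr_homD(3)[OF f] by (auto simp: homogeneous_def)
  have homl: "homogeneous \<Gamma> P J l d2" using l(1) hom2 by (auto simp: homogeneous_def)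
  have fb: "f \<circ> b1 \<in> I \<rightarrow> carrier P" by (rule P.homogeneous_closed[OF homf])
  have lP: "l \<in> J \<rightarrow> carrier P" by (rule P.homogeneous_closed[OF homl])
  define b where "b = case_sum (f \<circ> b1) l"
  have b: "b \<circ> Inl = f \<circ> b1" "b \<circ> Inr = l" by (auto simp: b_def fun_eq_iff)
  have bP: "b \<in> I <+> J \<rightarrow> carrier P" using fb lP by (auto simp: b_def)
  note flin = mod_hom_lincomb[OF P1.module_axioms P.module_axioms fm I _ b1]
  have glin: "g (lincomb P J c l) = lincomb P2 J c b2" if c: "c \<in> J \<rightarrow> carrier F" for c
  proof -
    have "g (lincomb P J c l) = lincomb P2 J c (g \<circ> l)"
      by (rule mod_hom_lincomb[OF P.module_axioms P2.module_axioms gm J c lP])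
    also have "\<dots> = lincomb P2 J c b2"
      using l(2) c b2 by (intro P2.lincomb_cong) auto
    finally show ?thesis .
  qed
  have g_add: "g (x \<oplus>\<^bsub>P\<^esub> y) = g x \<oplus>\<^bsub>P2\<^esub> g y" if "x \<in> carrier P" "y \<in> carrier P" for x y
    using gm that by (auto simp: mod_hom_def)
  have gf: "g (f x) = \<zero>\<^bsub>P2\<^esub>" if "x \<in> carrier P1" for x using ker that by blast
  have split: "lincomb P (I <+> J) c b = f (lincomb P1 I (c \<circ> Inl) b1) \<oplus>\<^bsub>P\<^esub> lincomb P J (c \<circ> Inr) l"
    if c: "c \<in> I <+> J \<rightarrow> carrier F" for c
  proof -
    have cl: "c \<circ> Inl \<in> I \<rightarrow> carrier F" using c by auto
    show ?thesis using P.lincomb_Plus[OF I J c bP] flin[OF cl] by (simp add: b)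
  qed
  have "homogeneous \<Gamma> P (I <+> J) b (case_sum d1 d2)"
    using homf homl by (auto simp: homogeneous_def b_def)
  moreover have "spanning F P (I <+> J) b"
    unfolding spanning_def
  proof
    fix y assume y: "y \<in> carrier P"
    then have "g y \<in> carrier P2" using gr_homD(2)[OF g] by auto
    then obtain c where c: "c \<in> J \<rightarrow> carrier F" "g y = lincomb P2 J c b2"
      using span2 unfolding spanning_def by blast
    \<comment> \<open>\<open>?z\<close> and \<open>y\<close> have the same image under
      \<open>g\<close>, so their difference comes from \<open>P1\<close>.\<close>
    let ?z = "lincomb P J c l"
    have z: "?z \<in> carrier P" using c(1) lP by (rule P.lincomb_closed)
    have z': "\<ominus>\<^bsub>P\<^esub> ?z = (\<ominus>\<^bsub>F\<^esub> \<one>\<^bsub>F\<^esub>) \<odot>\<^bsub>P\<^esub> ?z"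
      using z by (simp add: P.smult_l_minus)
    have "g (\<ominus>\<^bsub>P\<^esub> ?z) = \<ominus>\<^bsub>P2\<^esub> g ?z"
    proof -
      have "g ?z \<in> carrier P2" using gr_homD(2)[OF g] z by auto
      moreover have "g (\<ominus>\<^bsub>P\<^esub> ?z) = (\<ominus>\<^bsub>F\<^esub> \<one>\<^bsub>F\<^esub>) \<odot>\<^bsub>P2\<^esub> g ?z"
        unfolding z' using gm z by (simp add: mod_hom_def)
      ultimately show ?thesis by (simp add: P2.smult_l_minus)
    qed
    then have "g (y \<ominus>\<^bsub>P\<^esub> ?z) = \<zero>\<^bsub>P2\<^esub>"
      using y z g_add glin[OF c(1)] c(2) \<open>g y \<in> carrier P2\<close>
      by (simp add: P.M.minus_eq P2.M.r_neg)
    then have "y \<ominus>\<^bsub>P\<^esub> ?z \<in> f ` carrier P1" unfolding ker using y z by simp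
    then obtain x where x: "x \<in> carrier P1" "y \<ominus>\<^bsub>P\<^esub> ?z = f x" by blast
    obtain a where a: "a \<in> I \<rightarrow> carrier F" "x = lincomb P1 I a b1"
      using span1 x(1) unfolding spanning_def by blast
    have ac: "case_sum a c \<in> I <+> J \<rightarrow> carrier F" using a(1) c(1) by auto
    have "case_sum a c \<circ> Inl = a" "case_sum a c \<circ> Inr = c" by (auto simp: fun_eq_iff)
    then have "lincomb P (I <+> J) (case_sum a c) b = (y \<ominus>\<^bsub>P\<^esub> ?z) \<oplus>\<^bsub>P\<^esub> ?z"
      using split[OF ac] x(2) a(2) by simp
    also have "\<dots> = y" using y z by (simp add: P.M.minus_eq P.M.a_assoc P.M.l_neg)
    finally show "\<exists>c\<in>I <+> J \<rightarrow> carrier F. y = lincomb P (I <+> J) c b" using ac by metis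
  qed
  moreover have "lin_independent F P (I <+> J) b"
    unfolding lin_independent_def
  proof (intro ballI impI)
    fix c i assume c: "c \<in> I <+> J \<rightarrow> carrier F" and eq0: "lincomb P (I <+> J) c b = \<zero>\<^bsub>P\<^esub>"
      and i: "i \<in> I <+> J"
    have cl: "c \<circ> Inl \<in> I \<rightarrow> carrier F" and cr: "c \<circ> Inr \<in> J \<rightarrow> carrier F" using c by auto
    let ?x = "lincomb P1 I (c \<circ> Inl) b1" and ?z = "lincomb P J (c \<circ> Inr) l"
    have x: "?x \<in> carrier P1" using cl b1 by (rule P1.lincomb_closed)
    have fx: "f ?x \<in> carrier P" using gr_homD(2)[OF f] x by auto
    have z: "?z \<in> carrier P" using cr lP by (rule P.lincomb_closed)
    have s: "f ?x \<oplus>\<^bsub>P\<^esub> ?z = \<zero>\<^bsub>P\<^esub>" using split[OF c] eq0 by simp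
    have "g ?z \<in> carrier P2" using gr_homD(2)[OF g] z by auto
    \<comment> \<open>Applying \<open>g\<close> removes the contribution of \<open>P1\<close>, and
      independence of \<open>b2\<close> clears the coefficients on \<open>J\<close>. Injectivity of
      \<open>f\<close> then hands those on \<open>I\<close> to the independence of
      \<open>b1\<close>.\<close>
    then have "g ?z = g (f ?x \<oplus>\<^bsub>P\<^esub> ?z)"
      using g_add[OF fx z] gf[OF x] by simp
    also have "\<dots> = \<zero>\<^bsub>P2\<^esub>"
      using s mod_hom_zero[OF P.module_axioms P2.module_axioms gm] by simp
    finally have "lincomb P2 J (c \<circ> Inr) b2 = \<zero>\<^bsub>P2\<^esub>" using glin[OF cr] by simp
    then have r0: "\<forall>j\<in>J. (c \<circ> Inr) j = \<zero>\<^bsub>F\<^esub>" using ind2 cr unfolding lin_independent_def by blast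
    have "?z = \<zero>\<^bsub>P\<^esub>"
      unfolding lincomb_def using r0 lP by (intro P.M.add.finprod_one_eqI) (auto simp: Pi_iff)
    then have "f ?x = f \<zero>\<^bsub>P1\<^esub>"
      using s fx mod_hom_zero[OF P1.module_axioms P.module_axioms fm] by simp
    then have "?x = \<zero>\<^bsub>P1\<^esub>" using inj x by (auto simp: inj_on_def)
    then have "\<forall>i\<in>I. (c \<circ> Inl) i = \<zero>\<^bsub>F\<^esub>" using ind1 cl unfolding lin_independent_def by blast
    then show "c i = \<zero>\<^bsub>F\<^esub>" using r0 i by auto
  qed
  ultimately show ?thesis using I J by (auto simp: homogeneous_basis_def)
qed

section \<open>Standard graded modules\<close>

text \<open>The direct sum over \<open>i\<close> in \<open>I\<close> of copies of \<open>F\<close>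
  placed in degree \<open>d i\<close>. Functions are zero outside \<open>I\<close>, not
  \<open>undefined\<close>, so all operations are pointwise and enlarging \<open>I\<close> gives an
  honest inclusion of carriers. For \<open>'i = nat\<close> the carrier has the type required of
  \<open>Pgr_object\<close>.\<close>

definition std_module ::
    "('a, 'b) ring_scheme \<Rightarrow> 'i set \<Rightarrow> ('i \<Rightarrow> 'g) \<Rightarrow> ('a, 'i \<Rightarrow> 'a, 'g) gr_module" where
  "std_module F I d =
     \<lparr>carrier = {x. (\<forall>i\<in>I. x i \<in> carrier F) \<and> (\<forall>i. i \<notin> I \<longrightarrow> x i = \<zero>\<^bsub>F\<^esub>)},
      monoid.mult = undefined, one = undefined, ring.zero = (\<lambda>_. \<zero>\<^bsub>F\<^esub>),
      ring.add = (\<lambda>x y i. x i \<oplus>\<^bsub>F\<^esub> y i), smult = (\<lambda>a x i. a \<otimes>\<^bsub>F\<^esub> x i),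
      component = (\<lambda>\<gamma>. {x. (\<forall>i\<in>I. x i \<in> carrier F) \<and> (\<forall>i. i \<notin> I \<or> d i \<noteq> \<gamma> \<longrightarrow> x i = \<zero>\<^bsub>F\<^esub>)})\<rparr>"

lemma std_module_simps [simp]:
  "carrier (std_module F I d) = {x. (\<forall>i\<in>I. x i \<in> carrier F) \<and> (\<forall>i. i \<notin> I \<longrightarrow> x i = \<zero>\<^bsub>F\<^esub>)}"
  "\<zero>\<^bsub>std_module F I d\<^esub> = (\<lambda>_. \<zero>\<^bsub>F\<^esub>)"
  "x \<oplus>\<^bsub>std_module F I d\<^esub> y = (\<lambda>i. x i \<oplus>\<^bsub>F\<^esub> y i)"
  "a \<odot>\<^bsub>std_module F I d\<^esub> x = (\<lambda>i. a \<otimes>\<^bsub>F\<^esub> x i)"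
  "component (std_module F I d) \<gamma>
    = {x. (\<forall>i\<in>I. x i \<in> carrier F) \<and> (\<forall>i. i \<notin> I \<or> d i \<noteq> \<gamma> \<longrightarrow> x i = \<zero>\<^bsub>F\<^esub>)}"
  by (simp_all add: std_module_def)

definition std_unit :: "('a, 'b) ring_scheme \<Rightarrow> 'i \<Rightarrow> 'i \<Rightarrow> 'a" where
  "std_unit F i = (\<lambda>j. if j = i then \<one>\<^bsub>F\<^esub> else \<zero>\<^bsub>F\<^esub>)"

lemma std_module_module:
  fixes F :: "('a, 'b) ring_scheme" and I :: "'i set" and d :: "'i \<Rightarrow> 'g"
  assumes "cring F" shows "module F (std_module F I d)"
proof -
  interpret F: cring F by fact
  let ?M = "std_module F I d"
  have car: "x i \<in> carrier F" if "x \<in> carrier ?M" for x i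
    using that by (cases "i \<in> I") auto
  have ab: "abelian_group ?M"
  proof (rule abelian_groupI)
    fix x y z assume "x \<in> carrier ?M" "y \<in> carrier ?M" "z \<in> carrier ?M"
    note c = this[THEN car]
    show "x \<oplus>\<^bsub>?M\<^esub> y \<oplus>\<^bsub>?M\<^esub> z = x \<oplus>\<^bsub>?M\<^esub> (y \<oplus>\<^bsub>?M\<^esub> z)"
      using c by (simp add: F.a_assoc)
  next
    fix x y assume "x \<in> carrier ?M" "y \<in> carrier ?M"
    note c = this[THEN car]
    show "x \<oplus>\<^bsub>?M\<^esub> y = y \<oplus>\<^bsub>?M\<^esub> x"
      using c by (simp add: F.a_comm)
  next
    fix x assume x: "x \<in> carrier ?M"
    show "\<zero>\<^bsub>?M\<^esub> \<oplus>\<^bsub>?M\<^esub> x = x" using x[THEN car] by simp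
    show "\<exists>y\<in>carrier ?M. y \<oplus>\<^bsub>?M\<^esub> x = \<zero>\<^bsub>?M\<^esub>"
      using x x[THEN car] by (intro bexI[of _ "\<lambda>i. \<ominus>\<^bsub>F\<^esub> x i"]) (auto simp: F.l_neg)
  qed auto
  show ?thesis
  proof (rule moduleI)
    fix a b x assume ab: "a \<in> carrier F" "b \<in> carrier F" and x: "x \<in> carrier ?M"
    note c = x[THEN car]
    show "(a \<oplus>\<^bsub>F\<^esub> b) \<odot>\<^bsub>?M\<^esub> x = a \<odot>\<^bsub>?M\<^esub> x \<oplus>\<^bsub>?M\<^esub> b \<odot>\<^bsub>?M\<^esub> x"
      using ab c by (simp add: F.l_distr)
    show "(a \<otimes>\<^bsub>F\<^esub> b) \<odot>\<^bsub>?M\<^esub> x = a \<odot>\<^bsub>?M\<^esub> (b \<odot>\<^bsub>?M\<^esub> x)"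
      using ab c by (simp add: F.m_assoc)
  next
    fix a x y assume "a \<in> carrier F" "x \<in> carrier ?M" "y \<in> carrier ?M"
    then show "a \<odot>\<^bsub>?M\<^esub> (x \<oplus>\<^bsub>?M\<^esub> y) = a \<odot>\<^bsub>?M\<^esub> x \<oplus>\<^bsub>?M\<^esub> a \<odot>\<^bsub>?M\<^esub> y"
      using car[of x] car[of y] by (simp add: F.r_distr)
  next
    fix x assume "x \<in> carrier ?M"
    then show "\<one>\<^bsub>F\<^esub> \<odot>\<^bsub>?M\<^esub> x = x" using car[of x] by simp
  qed (use ab F.is_cring in auto)
qed

lemma std_module_finsum:
  fixes F :: "('a, 'b) ring_scheme" and I :: "'i set" and d :: "'i \<Rightarrow> 'g"
  assumes "cring F" "finite S" "x \<in> S \<rightarrow> carrier (std_module F I d)"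
  shows "(\<Oplus>\<^bsub>std_module F I d\<^esub>s\<in>S. x s) i = (\<Oplus>\<^bsub>F\<^esub>s\<in>S. x s i)"
proof -
  interpret F: cring F by fact
  interpret M: module F "std_module F I d" using assms(1) by (rule std_module_module)
  have car: "y i \<in> carrier F" if "y \<in> carrier (std_module F I d)" for y
    using that by (cases "i \<in> I") auto
  show ?thesis using assms(2,3)
  proof (induction S)
    case (insert s S)
    have "x \<in> S \<rightarrow> carrier (std_module F I d)" "x s \<in> carrier (std_module F I d)"
      using insert.prems by auto
    then have "finsum (std_module F I d) x (insert s S) = x s \<oplus>\<^bsub>std_module F I d\<^esub> finsum (std_module F I d) x S"
      and "(\<Oplus>\<^bsub>F\<^esub>s\<in>insert s S. x s i) = x s i \<oplus>\<^bsub>F\<^esub> (\<Oplus>\<^bsub>F\<^esub>s\<in>S. x s i)"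
      using insert.hyps car by (blast intro: M.M.finsum_insert F.finsum_insert)+
    then show ?case using insert by simp
  qed simp
qed

lemma std_module_graded_space:
  fixes \<Gamma> :: "('g, 'd) monoid_scheme" and F :: "('a, 'b) ring_scheme"
    and I :: "'i set" and d :: "'i \<Rightarrow> 'g"
  assumes \<Gamma>: "group \<Gamma>" and F: "field F" and I: "finite I" and d: "d \<in> I \<rightarrow> carrier \<Gamma>"
  shows "graded_space \<Gamma> F (std_module F I d)"
proof -
  interpret \<Gamma>: group \<Gamma> by fact
  interpret F: field F by fact
  let ?M = "std_module F I d"
  interpret M: module F ?M by (rule std_module_module[OF F.is_cring])
  have car: "x i \<in> carrier F" if "x \<in> carrier ?M" for x i
    using that by (cases "i \<in> I") auto
  have sub: "component ?M \<gamma> \<subseteq> carrier ?M" for \<gamma> by auto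
  have "internal_direct_sum (carrier \<Gamma>) ?M (component ?M)"
    unfolding internal_direct_sum_def
  proof (intro conjI ballI)
    fix \<gamma>
    show "additive_subgroup (component ?M \<gamma>) ?M"
    proof (rule additive_subgroup.intro, rule M.M.add.subgroupI)
      fix x assume x: "x \<in> component ?M \<gamma>"
      have "\<ominus>\<^bsub>?M\<^esub> x = (\<lambda>i. \<ominus>\<^bsub>F\<^esub> x i)"
        using x sub car[of x] by (intro M.M.minus_equality) (auto simp: F.l_neg)
      then show "\<ominus>\<^bsub>?M\<^esub> x \<in> component ?M \<gamma>" using x by auto
    next
      show "component ?M \<gamma> \<noteq> {}"
        by (auto intro!: exI[of _ "\<lambda>_. \<zero>\<^bsub>F\<^esub>"])
    qed (use sub in auto)
  next
    fix x assume x: "x \<in> carrier ?M"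
    \<comment> \<open>Coordinate \<open>i\<close> of a sum of homogeneous terms sees only the term
      of degree \<open>d i\<close>; this gives both existence and uniqueness of the
      decomposition.\<close>
    have coord: "(\<Oplus>\<^bsub>?M\<^esub>\<gamma>\<in>S. c \<gamma>) i = c (d i) i"
      if c: "c \<in> (\<Pi> \<gamma>\<in>carrier \<Gamma>. component ?M \<gamma>)" and S: "S = {\<gamma>\<in>carrier \<Gamma>. c \<gamma> \<noteq> \<zero>\<^bsub>?M\<^esub>}"
        and fin: "finite S" and i: "i \<in> I" for c S i
    proof -
      have di: "d i \<in> carrier \<Gamma>" using d i by auto
      have cM: "c \<gamma> \<in> carrier ?M" if "\<gamma> \<in> carrier \<Gamma>" for \<gamma> using c sub that by blast
      have z: "c \<gamma> i = \<zero>\<^bsub>F\<^esub>" if "\<gamma> \<in> carrier \<Gamma>" "\<gamma> \<noteq> d i" for \<gamma>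
        using c that by (auto simp: Pi_iff)
      have z': "c (d i) i = \<zero>\<^bsub>F\<^esub>" if "d i \<notin> S" using that S di by simp
      have cF: "c \<gamma> i \<in> carrier F" if "\<gamma> \<in> carrier \<Gamma>" for \<gamma> using car[OF cM[OF that]] .
      have S': "S \<subseteq> carrier \<Gamma>" using S by blast
      have "c \<in> S \<rightarrow> carrier ?M" using cM S' by blast
      with fin have "(\<Oplus>\<^bsub>?M\<^esub>\<gamma>\<in>S. c \<gamma>) i = (\<Oplus>\<^bsub>F\<^esub>\<gamma>\<in>S. c \<gamma> i)"
        by (rule std_module_finsum[OF F.is_cring])
      \<comment> \<open>The degree \<open>d i\<close> may be missing from the support
        \<open>S\<close>. It is added with a zero term, and then all other degrees are
        discarded.\<close>
      also have "\<dots> = (\<Oplus>\<^bsub>F\<^esub>\<gamma>\<in>insert (d i) S. c \<gamma> i)"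
        using fin S' di z' cF by (intro F.add.finprod_mono_neutral_cong_left) blast+
      also have "\<dots> = (\<Oplus>\<^bsub>F\<^esub>\<gamma>\<in>{d i}. c \<gamma> i)"
        using fin S' di cF z by (intro F.add.finprod_mono_neutral_cong_right) blast+
      also have "\<dots> = c (d i) i"
        using cF[OF di] by simp
      finally show ?thesis .
    qed
    let ?P = "\<lambda>c. c \<in> (\<Pi>\<^sub>E \<gamma>\<in>carrier \<Gamma>. component ?M \<gamma>) \<and> finite {\<gamma>\<in>carrier \<Gamma>. c \<gamma> \<noteq> \<zero>\<^bsub>?M\<^esub>} \<and>
        x = (\<Oplus>\<^bsub>?M\<^esub>\<gamma>\<in>{\<gamma>\<in>carrier \<Gamma>. c \<gamma> \<noteq> \<zero>\<^bsub>?M\<^esub>}. c \<gamma>)"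
    let ?c = "\<lambda>\<gamma>\<in>carrier \<Gamma>. \<lambda>i. if d i = \<gamma> then x i else \<zero>\<^bsub>F\<^esub>"
    show "\<exists>!c. ?P c"
    proof (rule ex1I)
      have c: "?c \<in> (\<Pi>\<^sub>E \<gamma>\<in>carrier \<Gamma>. component ?M \<gamma>)"
        using x by auto
      \<comment> \<open>Only degrees attained by \<open>d\<close> on \<open>I\<close> occur, so the
        support is finite because \<open>I\<close> is.\<close>
      have "{\<gamma>\<in>carrier \<Gamma>. ?c \<gamma> \<noteq> \<zero>\<^bsub>?M\<^esub>} \<subseteq> d ` I"
        using x by (auto simp: fun_eq_iff split: if_splits)
      then have fin: "finite {\<gamma>\<in>carrier \<Gamma>. ?c \<gamma> \<noteq> \<zero>\<^bsub>?M\<^esub>}" using I finite_subset by blast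
      have s: "(\<Oplus>\<^bsub>?M\<^esub>\<gamma>\<in>{\<gamma>\<in>carrier \<Gamma>. ?c \<gamma> \<noteq> \<zero>\<^bsub>?M\<^esub>}. ?c \<gamma>) \<in> carrier ?M"
        using c sub by (intro M.M.finsum_closed) (auto simp: PiE_iff)
      have "x i = (\<Oplus>\<^bsub>?M\<^esub>\<gamma>\<in>{\<gamma>\<in>carrier \<Gamma>. ?c \<gamma> \<noteq> \<zero>\<^bsub>?M\<^esub>}. ?c \<gamma>) i" for i
      proof (cases "i \<in> I")
        case True
        have c': "?c \<in> (\<Pi> \<gamma>\<in>carrier \<Gamma>. component ?M \<gamma>)" using c by (simp add: PiE_def)
        have "d i \<in> carrier \<Gamma>" using d True by auto
        then show ?thesis using coord[OF c' refl fin True] by simp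
      next
        case False
        then show ?thesis using s x by (simp del: restrict_apply)
      qed
      then show "?P ?c" using c fin by (intro conjI) (assumption | rule ext)+
    next
      fix c assume P: "?P c"
      then have c: "c \<in> (\<Pi>\<^sub>E \<gamma>\<in>carrier \<Gamma>. component ?M \<gamma>)" by blast
      then have c': "c \<in> (\<Pi> \<gamma>\<in>carrier \<Gamma>. component ?M \<gamma>)" by (simp add: PiE_def)
      have xi: "x i = c (d i) i" if "i \<in> I" for i
        using coord[OF c' refl _ that] P by metis
      show "c = ?c"
      proof
        fix \<gamma>
        show "c \<gamma> = ?c \<gamma>"
        proof (cases "\<gamma> \<in> carrier \<Gamma>")
          case True
          have "c \<gamma> i = (if d i = \<gamma> then x i else \<zero>\<^bsub>F\<^esub>)" for i
          proof (cases "i \<in> I")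
            case i: True
            then show ?thesis using c' True xi[OF i] by (auto simp: Pi_iff)
          next
            case False
            then show ?thesis using c' True x by (auto simp: Pi_iff)
          qed
          then show ?thesis using True by auto
        next
          case False
          then show ?thesis using c by (simp add: PiE_iff extensional_def)
        qed
      qed
    qed
  qed
  moreover have "a \<odot>\<^bsub>?M\<^esub> x \<in> component ?M (\<gamma> \<otimes>\<^bsub>\<Gamma>\<^esub> \<delta>)"
    if "\<gamma> \<in> carrier \<Gamma>" "\<delta> \<in> carrier \<Gamma>" "a \<in> trivial_grading \<Gamma> F \<gamma>" "x \<in> component ?M \<delta>" for \<gamma> \<delta> a x
    using that car[of x] by (auto simp: trivial_grading_def split: if_splits)
  ultimately have "graded_module \<Gamma> F (trivial_grading \<Gamma> F) ?M"
    by (rule graded_module.intro[OF graded_ring_trivial_grading[OF \<Gamma> F.ring_axioms] M.module_axioms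
          graded_module_axioms.intro])
  then show ?thesis using F by (intro graded_space.intro)
qed

lemma std_unit_closed: "cring F \<Longrightarrow> std_unit F \<in> I \<rightarrow> carrier (std_module F I d)"
  by (auto simp: std_unit_def cring.cring_simprules)

lemma std_module_lincomb:
  assumes F: "cring F" and I: "finite I" and x: "x \<in> carrier (std_module F I d)"
  shows "lincomb (std_module F I d) I x (std_unit F) = x"
proof
  fix i
  interpret F: cring F by fact
  let ?M = "std_module F I d"
  interpret M: module F ?M using F by (rule std_module_module)
  have e: "std_unit F \<in> I \<rightarrow> carrier ?M" by (rule std_unit_closed[OF F])
  have xF: "x \<in> I \<rightarrow> carrier F" using x by auto
  have "lincomb ?M I x (std_unit F) i = (\<Oplus>\<^bsub>F\<^esub>j\<in>I. x j \<otimes>\<^bsub>F\<^esub> std_unit F j i)"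
    unfolding lincomb_def using I xF e
    by (subst std_module_finsum[OF F I]) (auto simp: Pi_iff)
  also have "\<dots> = (\<Oplus>\<^bsub>F\<^esub>j\<in>I. if i = j then x j else \<zero>\<^bsub>F\<^esub>)"
    using xF by (intro F.finsum_cong') (auto simp: std_unit_def Pi_iff)
  also have "\<dots> = x i"
  proof (cases "i \<in> I")
    case True
    then show ?thesis using F.finsum_singleton[OF True I xF] by simp
  next
    case False
    then have "(\<Oplus>\<^bsub>F\<^esub>j\<in>I. if i = j then x j else \<zero>\<^bsub>F\<^esub>) = \<zero>\<^bsub>F\<^esub>"
      by (intro F.add.finprod_one_eqI) auto
    then show ?thesis using x False by simp
  qed
  finally show "lincomb ?M I x (std_unit F) i = x i" .
qed

lemma std_module_homogeneous_basis:
  assumes F: "field F" and I: "finite I" and d: "d \<in> I \<rightarrow> carrier \<Gamma>"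
  shows "homogeneous_basis \<Gamma> F (std_module F I d) I (std_unit F) d"
proof -
  interpret F: field F by fact
  let ?M = "std_module F I d"
  have "homogeneous \<Gamma> ?M I (std_unit F) d"
    using d by (auto simp: homogeneous_def std_unit_def)
  moreover have "spanning F ?M I (std_unit F)"
    unfolding spanning_def
  proof
    fix x assume "x \<in> carrier ?M"
    then show "\<exists>c\<in>I \<rightarrow> carrier F. x = lincomb ?M I c (std_unit F)"
      using std_module_lincomb[OF F.is_cring I, of x d] by (intro bexI[of _ x]) auto
  qed
  moreover have "lin_independent F ?M I (std_unit F)"
    unfolding lin_independent_def
  proof (intro ballI impI)
    fix c i assume c: "c \<in> I \<rightarrow> carrier F" "lincomb ?M I c (std_unit F) = \<zero>\<^bsub>?M\<^esub>" and i: "i \<in> I"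
    interpret M: module F ?M by (rule std_module_module[OF F.is_cring])
    let ?x = "\<lambda>i. if i \<in> I then c i else \<zero>\<^bsub>F\<^esub>"
    have "?x = lincomb ?M I ?x (std_unit F)"
      using c(1) by (intro std_module_lincomb[OF F.is_cring I, symmetric]) auto
    also have "\<dots> = lincomb ?M I c (std_unit F)"
      using c(1) std_unit_closed[OF F.is_cring, of I d]
      by (intro M.lincomb_cong) (auto simp del: std_module_simps)
    finally have "?x = (\<lambda>_. \<zero>\<^bsub>F\<^esub>)" using c(2) by simp
    from fun_cong[OF this, of i] show "c i = \<zero>\<^bsub>F\<^esub>" using i by simp
  qed
  ultimately show ?thesis using I by (simp add: homogeneous_basis_def)
qed

text \<open>\<open>finitely_generated\<close> sums over a set, so the family of unit vectors must be
  injective; it is, as \<open>\<one> \<noteq> \<zero>\<close> in a field.\<close>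

lemma std_module_finitely_generated:
  assumes F: "field F" and I: "finite I"
  shows "finitely_generated F (std_module F I d)"
proof -
  interpret F: field F by fact
  let ?M = "std_module F I d"
  interpret M: module F ?M by (rule std_module_module[OF F.is_cring])
  have e: "std_unit F \<in> I \<rightarrow> carrier ?M" by (rule std_unit_closed[OF F.is_cring])
  have inj: "inj_on (std_unit F) I"
    by (auto simp: inj_on_def std_unit_def fun_eq_iff split: if_splits)
  have "\<exists>c\<in>std_unit F ` I \<rightarrow> carrier F. x = (\<Oplus>\<^bsub>?M\<^esub>y\<in>std_unit F ` I. c y \<odot>\<^bsub>?M\<^esub> y)"
    if x: "x \<in> carrier ?M" for x
  proof (rule bexI)
    let ?c = "\<lambda>y. x (inv_into I (std_unit F) y)"
    have xF: "x \<in> I \<rightarrow> carrier F" using x by auto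
    show c: "?c \<in> std_unit F ` I \<rightarrow> carrier F"
      using xF inv_into_into[of _ "std_unit F" I] by blast
    have "(\<lambda>y. ?c y \<odot>\<^bsub>?M\<^esub> y) \<in> std_unit F ` I \<rightarrow> carrier ?M"
      using c e by (intro Pi_I M.smult_closed) blast+
    then have "(\<Oplus>\<^bsub>?M\<^esub>y\<in>std_unit F ` I. ?c y \<odot>\<^bsub>?M\<^esub> y)
        = (\<Oplus>\<^bsub>?M\<^esub>i\<in>I. ?c (std_unit F i) \<odot>\<^bsub>?M\<^esub> std_unit F i)"
      using inj by (rule M.M.finsum_reindex)
    also have "\<dots> = lincomb ?M I x (std_unit F)"
      unfolding lincomb_def using xF e inj
      by (intro M.M.finsum_cong' Pi_I M.smult_closed) (auto simp del: std_module_simps)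
    also have "\<dots> = x" using std_module_lincomb[OF F.is_cring I x] .
    finally show "x = (\<Oplus>\<^bsub>?M\<^esub>y\<in>std_unit F ` I. ?c y \<odot>\<^bsub>?M\<^esub> y)" ..
  qed
  moreover have "std_unit F ` I \<subseteq> carrier ?M" using e by blast
  ultimately show ?thesis
    using I unfolding finitely_generated_def by (intro exI[of _ "std_unit F ` I"]) blast
qed

text \<open>Preimages of the images of the unit vectors are chosen and extended linearly.\<close>

lemma std_module_projective:
  assumes F: "field F" and I: "finite I"
  shows "projective F (std_module F I d)"
  unfolding projective_def
proof (intro allI ballI impI)
  interpret F: field F by fact
  let ?M = "std_module F I d"
  interpret M: module F ?M by (rule std_module_module[OF F.is_cring])
  have e: "std_unit F \<in> I \<rightarrow> carrier ?M" by (rule std_unit_closed[OF F.is_cring])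
  fix P Q :: "('a, nat \<Rightarrow> 'a) module" and g f
  assume g: "g \<in> mod_hom F P Q" and f: "f \<in> mod_hom F ?M Q" and "module F P" "module F Q"
    and surj: "g ` carrier P = carrier Q"
  interpret P: module F P by fact
  interpret Q: module F Q by fact
  have fc: "f x \<in> carrier Q" if "x \<in> carrier ?M" for x using f that unfolding mod_hom_def by blast
  have fe: "f (std_unit F i) \<in> carrier Q" if "i \<in> I" for i
    by (rule fc, rule funcset_mem[OF e that])
  have "\<exists>p\<in>carrier P. g p = f (std_unit F i)" if "i \<in> I" for i
  proof -
    have "f (std_unit F i) \<in> g ` carrier P" unfolding surj by (rule fe[OF that])
    then show ?thesis by auto
  qed
  then obtain p where p: "\<And>i. i \<in> I \<Longrightarrow> p i \<in> carrier P" "\<And>i. i \<in> I \<Longrightarrow> g (p i) = f (std_unit F i)"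
    by metis
  define h where "h x = lincomb P I x p" for x
  have pP: "p \<in> I \<rightarrow> carrier P" using p(1) by auto
  have xF: "x \<in> I \<rightarrow> carrier F" if "x \<in> carrier ?M" for x using that by auto
  have "h \<in> mod_hom F ?M P"
    unfolding mod_hom_def
  proof (intro CollectI conjI ballI)
    show "h \<in> carrier ?M \<rightarrow> carrier P"
      unfolding h_def by (rule Pi_I, rule P.lincomb_closed[OF xF pP])
    fix x assume x: "x \<in> carrier ?M"
    show "h (x \<oplus>\<^bsub>?M\<^esub> y) = h x \<oplus>\<^bsub>P\<^esub> h y" if y: "y \<in> carrier ?M" for y
      unfolding h_def using P.lincomb_add[OF xF[OF x] xF[OF y] pP] by simp
    show "h (a \<odot>\<^bsub>?M\<^esub> x) = a \<odot>\<^bsub>P\<^esub> h x" if a: "a \<in> carrier F" for a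
      unfolding h_def using P.lincomb_smult[OF I xF[OF x] a pP] by simp
  qed
  moreover have "g (h x) = f x" if x: "x \<in> carrier ?M" for x
  proof -
    have "g (h x) = lincomb Q I x (g \<circ> p)"
      unfolding h_def by (rule mod_hom_lincomb[OF P.module_axioms Q.module_axioms g I xF[OF x] pP])
    also have "\<dots> = lincomb Q I x (f \<circ> std_unit F)"
      using xF[OF x] p(2) fe by (intro Q.lincomb_cong) auto
    also have "\<dots> = f (lincomb ?M I x (std_unit F))"
      by (rule mod_hom_lincomb[OF M.module_axioms Q.module_axioms f I xF[OF x] e, symmetric])
    also have "\<dots> = f x" using std_module_lincomb[OF F.is_cring I x] by simp
    finally show ?thesis .
  qed
  ultimately show "\<exists>h\<in>mod_hom F ?M P. \<forall>x\<in>carrier ?M. g (h x) = f x" by blast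
qed

lemma std_module_Pgr:
  assumes "group \<Gamma>" "field F" "finite I" "d \<in> I \<rightarrow> carrier \<Gamma>"
  shows "std_module F I d \<in> Pgr \<Gamma> F (trivial_grading \<Gamma> F)"
proof -
  interpret graded_space \<Gamma> F "std_module F I d" by (rule std_module_graded_space[OF assms])
  show ?thesis
    using graded_module_axioms
    by (simp add: Pgr_def std_module_finitely_generated[OF assms(2,3)] std_module_projective[OF assms(2,3)])
qed

text \<open>The isomorphism sends a coordinate vector to the combination it describes. It respects
  degrees because a vector in the component \<open>\<gamma>\<close> is supported on the indices with
  \<open>d i = \<gamma>\<close>.\<close>

lemma std_module_gr_isomorphic:
  assumes M: "graded_space \<Gamma> F M" and B: "homogeneous_basis \<Gamma> F M I b d"
  shows "gr_isomorphic \<Gamma> F (std_module F I d) M"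
proof -
  interpret graded_space \<Gamma> F M by fact
  let ?S = "std_module F I d"
  have I: "finite I" and hom: "homogeneous \<Gamma> M I b d" and span: "spanning F M I b"
    and ind: "lin_independent F M I b"
    using B by (auto simp: homogeneous_basis_def)
  have b: "b \<in> I \<rightarrow> carrier M" by (rule homogeneous_closed[OF hom])
  define h where "h x = lincomb M I x b" for x
  have xF: "x \<in> I \<rightarrow> carrier F" if "x \<in> carrier ?S" for x using that by auto
  have "h \<in> mod_hom F ?S M"
    unfolding mod_hom_def
  proof (intro CollectI conjI ballI)
    show "h \<in> carrier ?S \<rightarrow> carrier M"
      unfolding h_def by (rule Pi_I, rule lincomb_closed[OF xF b])
    fix x assume x: "x \<in> carrier ?S"
    show "h (x \<oplus>\<^bsub>?S\<^esub> y) = h x \<oplus>\<^bsub>M\<^esub> h y" if y: "y \<in> carrier ?S" for y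
      unfolding h_def using lincomb_add[OF xF[OF x] xF[OF y] b] by simp
    show "h (a \<odot>\<^bsub>?S\<^esub> x) = a \<odot>\<^bsub>M\<^esub> h x" if a: "a \<in> carrier F" for a
      unfolding h_def using lincomb_smult[OF I xF[OF x] a b] by simp
  qed
  moreover have "h x \<in> component M \<gamma>" if \<gamma>: "\<gamma> \<in> carrier \<Gamma>" and x: "x \<in> component ?S \<gamma>" for x \<gamma>
    unfolding h_def lincomb_def
  proof (rule M.finsum_in_subset[OF component_subset[OF \<gamma>] component_zero[OF \<gamma>] component_add[OF \<gamma>]])
    show "(\<lambda>i. x i \<odot>\<^bsub>M\<^esub> b i) \<in> I \<rightarrow> component M \<gamma>"
    proof
      fix i assume i: "i \<in> I"
      then have bi: "b i \<in> component M (d i)" "b i \<in> carrier M" using hom b by (auto simp: homogeneous_def)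
      show "x i \<odot>\<^bsub>M\<^esub> b i \<in> component M \<gamma>"
      proof (cases "d i = \<gamma>")
        case True
        then show ?thesis using component_smult[OF \<gamma>, of "x i" "b i"] bi x i by simp
      next
        case False
        then show ?thesis using x bi component_zero[OF \<gamma>] by simp
      qed
    qed
  qed
  ultimately have "h \<in> gr_hom \<Gamma> F ?S M" unfolding gr_hom_def by blast
  moreover have "bij_betw h (carrier ?S) (carrier M)"
    unfolding bij_betw_def
  proof
    show "inj_on h (carrier ?S)"
    proof (rule inj_onI)
      fix x y assume x: "x \<in> carrier ?S" and y: "y \<in> carrier ?S" and eq: "h x = h y"
      have hy: "h y \<in> carrier M" unfolding h_def using xF[OF y] b by (rule lincomb_closed)
      have "lincomb M I (\<lambda>i. x i \<ominus>\<^bsub>F\<^esub> y i) b = h x \<ominus>\<^bsub>M\<^esub> h y"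
        unfolding h_def using lincomb_diff[OF I xF[OF x] xF[OF y] b] .
      also have "\<dots> = \<zero>\<^bsub>M\<^esub>" using hy eq by (simp add: M.minus_eq M.r_neg)
      finally have z: "lincomb M I (\<lambda>i. x i \<ominus>\<^bsub>F\<^esub> y i) b = \<zero>\<^bsub>M\<^esub>" .
      have "(\<lambda>i. x i \<ominus>\<^bsub>F\<^esub> y i) \<in> I \<rightarrow> carrier F" using x y by auto
      then have "\<forall>i\<in>I. x i \<ominus>\<^bsub>F\<^esub> y i = \<zero>\<^bsub>F\<^esub>"
        by (rule mp[OF bspec[OF ind[unfolded lin_independent_def]] z])
      then have "x i = y i" if "i \<in> I" for i using that x y by simp
      \<comment> \<open>Off \<open>I\<close> both functions are zero by membership in the
        carrier.\<close>
      then show "x = y" using x y by (auto simp: fun_eq_iff) metis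
    qed
    have "y \<in> h ` carrier ?S" if y: "y \<in> carrier M" for y
    proof -
      obtain c where c: "c \<in> I \<rightarrow> carrier F" "y = lincomb M I c b"
        using span y unfolding spanning_def by blast
      let ?x = "\<lambda>i. if i \<in> I then c i else \<zero>\<^bsub>F\<^esub>"
      have "h ?x = y" unfolding h_def c(2) using c(1) b by (intro lincomb_cong) auto
      moreover have "?x \<in> carrier ?S" using c(1) by auto
      ultimately show ?thesis by blast
    qed
    moreover have "h ` carrier ?S \<subseteq> carrier M"
      unfolding h_def by (rule image_subsetI, rule lincomb_closed[OF xF b])
    ultimately show "h ` carrier ?S = carrier M" by blast
  qed
  ultimately show ?thesis unfolding gr_isomorphic_def by blast
qed

section \<open>Splitting off one-dimensional modules\<close>

text \<open>The inclusion is \<open>id\<close>, and the quotient map reads off coordinate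
  \<open>n\<close>. Moving it to the fixed index \<open>0\<close> makes the third term depend on the
  degree \<open>d n\<close> alone.\<close>

lemma std_module_short_exact_insert:
  fixes d :: "nat \<Rightarrow> 'g"
  assumes F: "field F" and n: "n \<notin> I"
  shows "short_exact \<Gamma> F (std_module F I d) (std_module F (insert n I) d) (std_module F {0} (\<lambda>_. d n))"
proof -
  interpret F: field F by fact
  let ?P1 = "std_module F I d" and ?P = "std_module F (insert n I) d"
    and ?P2 = "std_module F {0::nat} (\<lambda>_. d n)"
  define g :: "(nat \<Rightarrow> 'a) \<Rightarrow> nat \<Rightarrow> 'a" where "g x = (\<lambda>j. if j = 0 then x n else \<zero>\<^bsub>F\<^esub>)" for x
  have "id \<in> gr_hom \<Gamma> F ?P1 ?P"
    by (auto simp: gr_hom_def mod_hom_def)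
  moreover have "g \<in> gr_hom \<Gamma> F ?P ?P2"
    by (auto simp: gr_hom_def mod_hom_def g_def fun_eq_iff)
  moreover have "id ` carrier ?P1 = {x \<in> carrier ?P. g x = \<zero>\<^bsub>?P2\<^esub>}"
    using n by (auto simp: g_def fun_eq_iff)
  moreover have "g ` carrier ?P = carrier ?P2"
  proof (intro equalityI subsetI)
    fix y assume y: "y \<in> carrier ?P2"
    let ?x = "\<lambda>i. if i = n then y 0 else \<zero>\<^bsub>F\<^esub>"
    have "g ?x = y" using y by (auto simp: g_def fun_eq_iff)
    moreover have "?x \<in> carrier ?P" using y by auto
    ultimately show "y \<in> g ` carrier ?P" by (metis image_eqI)
  qed (auto simp: g_def)
  ultimately show ?thesis unfolding short_exact_def
    by (intro bexI[of _ id] bexI[of _ g] conjI inj_on_id)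
qed

text \<open>Supplies the relation that makes the class of the zero module vanish.\<close>

lemma std_module_short_exact_empty:
  assumes F: "field F"
  shows "short_exact \<Gamma> F (std_module F {} d) (std_module F {} d) (std_module F {} d)"
proof -
  interpret F: field F by fact
  let ?P = "std_module F {} d"
  have "carrier ?P = {\<lambda>_. \<zero>\<^bsub>F\<^esub>}" by (auto simp: fun_eq_iff)
  then show ?thesis unfolding short_exact_def
    by (intro bexI[of _ id] conjI inj_on_id) (auto simp: gr_hom_def mod_hom_def)
qed

section \<open>Generators and relations\<close>

text \<open>Let \<open>\<psi>\<close> extend \<open>s\<close> linearly. By linearity
  \<open>gen\<close> puts \<open>z - \<psi> (r z)\<close> into \<open>N\<close> for every
  \<open>z\<close>, so \<open>r z = 0\<close> forces \<open>z\<close> into \<open>N\<close>; the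
  other inclusion is \<open>r_R\<close>. Surjectivity holds because \<open>\<psi>\<close> is a
  section of the extension of \<open>r\<close>.\<close>

lemma free_Abelian_group_Mod_iso:
  fixes C :: "'c set" and G :: "'g set" and R :: "('c \<Rightarrow>\<^sub>0 int) set"
    and r :: "'c \<Rightarrow> 'g \<Rightarrow>\<^sub>0 int" and s :: "'g \<Rightarrow> 'c"
  defines "N \<equiv> generate (free_Abelian_group C) R"
  assumes R: "R \<subseteq> carrier (free_Abelian_group C)"
    and r: "\<And>K. K \<in> C \<Longrightarrow> r K \<in> carrier (free_Abelian_group G)"
    and r_R: "\<And>\<rho>. \<rho> \<in> R \<Longrightarrow> frag_extend r \<rho> = 0"
    and s: "\<And>\<gamma>. \<gamma> \<in> G \<Longrightarrow> s \<gamma> \<in> C" "\<And>\<gamma>. \<gamma> \<in> G \<Longrightarrow> r (s \<gamma>) = frag_of \<gamma>"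
    and gen: "\<And>K. K \<in> C \<Longrightarrow> frag_of K - frag_extend (\<lambda>\<gamma>. frag_of (s \<gamma>)) (r K) \<in> N"
  shows "free_Abelian_group C Mod N \<cong> free_Abelian_group G"
proof -
  let ?Z = "free_Abelian_group C" and ?H = "free_Abelian_group G"
  interpret Z: group ?Z by simp
  have cl: "frag_extend r z \<in> carrier ?H" if "z \<in> carrier ?Z" for z
    using that r keys_frag_extend[of r z] by fastforce
  interpret \<phi>: group_hom ?Z ?H "frag_extend r"
  proof (intro group_hom.intro group_hom_axioms.intro homI)
    fix x y assume "x \<in> carrier ?Z" "y \<in> carrier ?Z"
    show "frag_extend r (x \<otimes>\<^bsub>?Z\<^esub> y) = frag_extend r x \<otimes>\<^bsub>?H\<^esub> frag_extend r y"
      by (simp add: frag_extend_add)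
  qed (use cl in simp_all)
  have N: "subgroup N ?Z" unfolding N_def using R by (rule Z.generate_is_subgroup)
  have N0: "0 \<in> N" using subgroup.one_closed[OF N] by simp
  have Ndiff: "x - y \<in> N" if "x \<in> N" "y \<in> N" for x y
  proof -
    have y: "y \<in> carrier ?Z" using subgroup.subset[OF N] that by blast
    then have "x \<otimes>\<^bsub>?Z\<^esub> inv\<^bsub>?Z\<^esub> y = x - y" by simp
    then show ?thesis
      using subgroup.m_closed[OF N that(1) subgroup.m_inv_closed[OF N that(2)]] by simp
  qed
  let ?\<psi> = "frag_extend (\<lambda>\<gamma>. frag_of (s \<gamma>))"
  have red: "z - ?\<psi> (frag_extend r z) \<in> N" if "Poly_Mapping.keys z \<subseteq> C" for z
    using that
  proof (induction z rule: frag_induction)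
    case (diff a b)
    have eq: "a - b - ?\<psi> (frag_extend r (a - b))
        = (a - ?\<psi> (frag_extend r a)) - (b - ?\<psi> (frag_extend r b))"
      by (simp add: frag_extend_diff)
    show ?case unfolding eq using diff by (rule Ndiff)
  qed (use N0 gen in auto)
  have sec: "Poly_Mapping.keys w \<subseteq> G \<Longrightarrow> frag_extend r (?\<psi> w) = w" for w
  proof (induction w rule: frag_induction)
    case (diff a b)
    then show ?case by (simp add: frag_extend_diff)
  qed (use s in auto)
  have "kernel ?Z ?H (frag_extend r) = N"
  proof
    show "kernel ?Z ?H (frag_extend r) \<subseteq> N"
    proof
      fix z assume "z \<in> kernel ?Z ?H (frag_extend r)"
      then have "Poly_Mapping.keys z \<subseteq> C" "frag_extend r z = 0" by (auto simp: kernel_def)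
      then show "z \<in> N" using red[of z] by simp
    qed
    have "R \<subseteq> kernel ?Z ?H (frag_extend r)" using subsetD[OF R] r_R
      by (auto simp: kernel_def simp del: carrier_free_Abelian_group_iff)
    then show "N \<subseteq> kernel ?Z ?H (frag_extend r)"
      unfolding N_def by (rule Z.generate_subgroup_incl[OF _ \<phi>.subgroup_kernel])
  qed
  moreover have "frag_extend r ` carrier ?Z = carrier ?H"
  proof
    show "frag_extend r ` carrier ?Z \<subseteq> carrier ?H" using cl by blast
    show "carrier ?H \<subseteq> frag_extend r ` carrier ?Z"
    proof
      fix w assume "w \<in> carrier ?H"
      then have w: "Poly_Mapping.keys w \<subseteq> G" by simp
      have "Poly_Mapping.keys (?\<psi> w) \<subseteq> C"
        using keys_frag_extend[of "\<lambda>\<gamma>. frag_of (s \<gamma>)" w] s(1) w by fastforce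
      then show "w \<in> frag_extend r ` carrier ?Z" using sec[OF w] by (intro image_eqI[of _ _ "?\<psi> w"]) auto
    qed
  qed
  ultimately show ?thesis using \<phi>.FactGroup_iso by simp
qed

section \<open>The degree invariant\<close>

text \<open>As a finitely supported function this is the graded dimension, sending
  \<open>\<gamma>\<close> to the dimension of \<open>M\<^sub>\<gamma>\<close>. One index type has to
  be fixed here; \<open>degrees_eq\<close> then allows bases over any index type.\<close>

definition degrees ::
    "('g, 'd) monoid_scheme \<Rightarrow> ('a, 'b) ring_scheme \<Rightarrow> ('a, 'm, 'g) gr_module \<Rightarrow> 'g \<Rightarrow>\<^sub>0 int" where
  "degrees \<Gamma> F M = (SOME w. \<exists>(I::nat set) b d. homogeneous_basis \<Gamma> F M I b d \<and> w = (\<Sum>i\<in>I. frag_of (d i)))"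

lemma (in graded_space) degrees_eq:
  assumes fg: "finitely_generated F M" and B: "homogeneous_basis \<Gamma> F M I b d"
  shows "degrees \<Gamma> F M = (\<Sum>i\<in>I. frag_of (d i))"
proof -
  have "\<exists>w. \<exists>(I::nat set) b d. homogeneous_basis \<Gamma> F M I b d \<and> w = (\<Sum>i\<in>I. frag_of (d i))"
    using exists_homogeneous_basis[OF fg] by blast
  from someI_ex[OF this] obtain J :: "nat set" and w e where
    B': "homogeneous_basis \<Gamma> F M J w e" and "degrees \<Gamma> F M = (\<Sum>j\<in>J. frag_of (e j))"
    unfolding degrees_def by blast
  then show ?thesis using homogeneous_basis_degrees_unique[OF B B'] by simp
qed

section \<open>The graded Grothendieck group of a trivially graded field\<close>

theorem proposition5p1p4:
  fixes F :: "('a, 'b) ring_scheme" and \<Gamma> :: "('g, 'd) monoid_scheme"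
  assumes "field F" and "group \<Gamma>"
  shows "K0gr \<Gamma> F (trivial_grading \<Gamma> F) \<cong> sum_group (carrier \<Gamma>) (\<lambda>\<gamma>. integer_group)"
proof -
  interpret F: field F by fact
  interpret \<Gamma>: group \<Gamma> by fact
  define \<P> :: "('a, 'g) Pgr_object set" where "\<P> = Pgr \<Gamma> F (trivial_grading \<Gamma> F)"
  define cls where "cls = iso_class \<Gamma> F (trivial_grading \<Gamma> F)"
  define R where "R = K0gr_relations \<Gamma> F (trivial_grading \<Gamma> F)"
  define Z where "Z = free_Abelian_group (cls ` \<P>)"
  define N where "N = generate Z R"
  \<comment> \<open>A class is a set of isomorphic modules; \<open>deg_iso\<close> below shows that
    every representative gives the same value.\<close>
  define r where "r K = degrees \<Gamma> F (SOME P. P \<in> K)" for K :: "('a, 'g) Pgr_object set"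
  have P: "graded_space \<Gamma> F P" "finitely_generated F P" if "P \<in> \<P>" for P
    using that \<open>field F\<close> by (auto simp: \<P>_def Pgr_def intro: graded_space.intro)
  have basis: "\<exists>(I::nat set) b d. homogeneous_basis \<Gamma> F P I b d" if "P \<in> \<P>" for P
    using graded_space.exists_homogeneous_basis[OF P(1,2)[OF that]] .
  have deg_iso: "degrees \<Gamma> F P = degrees \<Gamma> F Q"
    if PQ: "P \<in> \<P>" "Q \<in> \<P>" "gr_isomorphic \<Gamma> F P Q" for P Q
  proof -
    obtain f where f: "f \<in> gr_hom \<Gamma> F P Q" "bij_betw f (carrier P) (carrier Q)"
      using PQ(3) by (auto simp: gr_isomorphic_def)
    obtain I :: "nat set" and b d where B: "homogeneous_basis \<Gamma> F P I b d" using basis[OF PQ(1)] by blast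
    have B': "homogeneous_basis \<Gamma> F Q I (f \<circ> b) d"
      by (rule homogeneous_basis_iso[OF P(1)[OF PQ(1)] P(1)[OF PQ(2)] f B])
    show ?thesis
      using graded_space.degrees_eq[OF P[OF PQ(1)] B] graded_space.degrees_eq[OF P[OF PQ(2)] B'] by simp
  qed
  have r: "r (cls P) = degrees \<Gamma> F P" if "P \<in> \<P>" for P
  proof -
    have "P \<in> cls P" using that gr_isomorphic_refl by (simp add: cls_def iso_class_def \<P>_def)
    then have "(SOME P'. P' \<in> cls P) \<in> cls P" by (rule someI)
    then have "(SOME P'. P' \<in> cls P) \<in> \<P>" "gr_isomorphic \<Gamma> F P (SOME P'. P' \<in> cls P)"
      by (simp_all add: cls_def iso_class_def \<P>_def)
    then show ?thesis unfolding r_def using deg_iso[OF that] by metis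
  qed
  have cls_eq: "cls P = cls Q" if "P \<in> \<P>" "Q \<in> \<P>" "gr_isomorphic \<Gamma> F P Q" for P Q
    using gr_isomorphic_trans gr_isomorphic_sym[OF P(1)[OF that(1)] P(1)[OF that(2)] that(3)] that(3)
    unfolding cls_def iso_class_def by blast
  have std: "std_module F I d \<in> \<P>" if "finite I" "d \<in> I \<rightarrow> carrier \<Gamma>" for I :: "nat set" and d
    unfolding \<P>_def using std_module_Pgr[OF \<open>group \<Gamma>\<close> \<open>field F\<close> that] .
  \<comment> \<open>The index set \<open>{0}\<close> is the one used for the quotient in
    \<open>std_module_short_exact_insert\<close>.\<close>
  define s where "s \<gamma> = cls (std_module F {0::nat} (\<lambda>_. \<gamma>))" for \<gamma>
  have R_sub: "R \<subseteq> carrier Z"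
  proof
    fix \<rho> assume "\<rho> \<in> R"
    then obtain P1 P P2 where "P1 \<in> \<P>" "P \<in> \<P>" "P2 \<in> \<P>"
      "\<rho> = frag_of (cls P) - (frag_of (cls P1) + frag_of (cls P2))"
      unfolding R_def K0gr_relations_def \<P>_def cls_def by blast
    moreover have "Poly_Mapping.keys (a - (b + c))
        \<subseteq> Poly_Mapping.keys a \<union> (Poly_Mapping.keys b \<union> Poly_Mapping.keys c)" for a b c :: "('a, 'g) Pgr_object set \<Rightarrow>\<^sub>0 int"
      using keys_diff[of a "b + c"] keys_add[of b c] by blast
    ultimately show "\<rho> \<in> carrier Z" unfolding Z_def by fastforce
  qed
  have ses: "frag_of (cls P) - (frag_of (cls P1) + frag_of (cls P2)) \<in> N"
    if "P1 \<in> \<P>" "P \<in> \<P>" "P2 \<in> \<P>" "short_exact \<Gamma> F P1 P P2" for P1 P P2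
    unfolding N_def using that
    by (intro generate.incl) (auto simp: R_def K0gr_relations_def \<P>_def cls_def)
  interpret Z: group Z unfolding Z_def by simp
  have N: "subgroup N Z" unfolding N_def using R_sub by (rule Z.generate_is_subgroup)
  have N0: "0 \<in> N" using subgroup.one_closed[OF N] by (simp add: Z_def)
  have Nadd: "x + y \<in> N" if "x \<in> N" "y \<in> N" for x y
    using subgroup.m_closed[OF N that] by (simp add: Z_def)
  have Nneg: "- x \<in> N" if "x \<in> N" for x
  proof -
    have "x \<in> carrier Z" using subgroup.subset[OF N] that by blast
    then show ?thesis using subgroup.m_inv_closed[OF N that] by (simp add: Z_def)
  qed
  \<comment> \<open>Induction on the index set: the relations obtained by splitting off one
    coordinate at a time add up in \<open>N\<close>.\<close>
  have red: "frag_of (cls (std_module F I d)) - (\<Sum>i\<in>I. frag_of (s (d i))) \<in> N"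
    if "finite I" "d \<in> I \<rightarrow> carrier \<Gamma>" for I :: "nat set" and d
    using that
  proof (induction I)
    case empty
    have "std_module F {} d \<in> \<P>" by (rule std) auto
    \<comment> \<open>The exact sequence of zero modules gives
      \<open>[0] - ([0] + [0]) = - [0]\<close>.\<close>
    then have "- frag_of (cls (std_module F {} d)) \<in> N"
      using ses[OF _ _ _ std_module_short_exact_empty[OF \<open>field F\<close>]] by fastforce
    then show ?case using Nneg by fastforce
  next
    case (insert n I)
    have d: "d \<in> I \<rightarrow> carrier \<Gamma>" "d n \<in> carrier \<Gamma>" using insert.prems by auto
    have "frag_of (cls (std_module F (insert n I) d))
        - (frag_of (cls (std_module F I d)) + frag_of (s (d n))) \<in> N"
      unfolding s_def using insert d
      by (intro ses std std_module_short_exact_insert \<open>field F\<close>) auto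
    from Nadd[OF this insert.IH[OF d(1)]] show ?case
      using insert.hyps by (simp add: algebra_simps)
  qed
  have "Z Mod N \<cong> free_Abelian_group (carrier \<Gamma>)"
    unfolding Z_def N_def
  proof (rule free_Abelian_group_Mod_iso[where r = r and s = s])
    show "R \<subseteq> carrier (free_Abelian_group (cls ` \<P>))" using R_sub by (simp add: Z_def)
  next
    fix K assume "K \<in> cls ` \<P>"
    then obtain P where P': "P \<in> \<P>" "K = cls P" by blast
    obtain I :: "nat set" and b d where B: "homogeneous_basis \<Gamma> F P I b d" using basis[OF P'(1)] by blast
    have I: "finite I" and dI: "d \<in> I \<rightarrow> carrier \<Gamma>"
      using B by (auto simp: homogeneous_basis_def homogeneous_def)
    have rX: "r K = (\<Sum>i\<in>I. frag_of (d i))" using r[OF P'(1)] graded_space.degrees_eq[OF P[OF P'(1)] B] P'(2) by simp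
    show "r K \<in> carrier (free_Abelian_group (carrier \<Gamma>))"
      unfolding rX using dI by (intro sum_closed_free_Abelian_group) auto
    \<comment> \<open>Passing to the standard module on the same degrees reduces the congruence for
      \<open>K\<close> to \<open>red\<close>.\<close>
    have "cls (std_module F I d) = K"
      unfolding P'(2)
      by (rule cls_eq[OF std[OF I dI] P'(1) std_module_gr_isomorphic[OF P(1)[OF P'(1)] B]])
    then show "frag_of K - frag_extend (\<lambda>\<gamma>. frag_of (s \<gamma>)) (r K)
        \<in> generate (free_Abelian_group (cls ` \<P>)) R"
      using red[OF I dI] I unfolding rX N_def Z_def by (simp add: frag_extend_sum comp_def)
  next
    fix \<rho> assume "\<rho> \<in> R"
    then obtain P1 P' P2 where Ps: "P1 \<in> \<P>" "P' \<in> \<P>" "P2 \<in> \<P>" "short_exact \<Gamma> F P1 P' P2"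
      "\<rho> = frag_of (cls P') - (frag_of (cls P1) + frag_of (cls P2))"
      unfolding R_def K0gr_relations_def \<P>_def cls_def by blast
    obtain I :: "nat set" and b d where B: "homogeneous_basis \<Gamma> F P1 I b d" using basis[OF Ps(1)] by blast
    obtain J :: "nat set" and w e where B': "homogeneous_basis \<Gamma> F P2 J w e" using basis[OF Ps(3)] by blast
    \<comment> \<open>With a basis over the disjoint union, additivity of \<open>degrees\<close> is
      the splitting of a sum over \<open>I <+> J\<close>.\<close>
    obtain v where B'': "homogeneous_basis \<Gamma> F P' (I <+> J) v (case_sum d e)"
      using homogeneous_basis_short_exact[OF P(1)[OF Ps(1)] P(1)[OF Ps(2)] P(1)[OF Ps(3)] Ps(4) B B'] by blast
    have "finite I" "finite J" using B B' by (auto simp: homogeneous_basis_def)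
    then have "degrees \<Gamma> F P' = degrees \<Gamma> F P1 + degrees \<Gamma> F P2"
      using graded_space.degrees_eq[OF P[OF Ps(1)] B] graded_space.degrees_eq[OF P[OF Ps(3)] B']
        graded_space.degrees_eq[OF P[OF Ps(2)] B''] by (simp add: sum.Plus)
    then show "frag_extend r \<rho> = 0"
      unfolding Ps(5) by (simp add: frag_extend_diff frag_extend_add r Ps)
  next
    fix \<gamma> assume \<gamma>: "\<gamma> \<in> carrier \<Gamma>"
    then have S: "std_module F {0::nat} (\<lambda>_. \<gamma>) \<in> \<P>" by (intro std) auto
    then show "s \<gamma> \<in> cls ` \<P>" by (simp add: s_def)
    have B: "homogeneous_basis \<Gamma> F (std_module F {0::nat} (\<lambda>_. \<gamma>)) {0} (std_unit F) (\<lambda>_. \<gamma>)"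
      using \<gamma> by (intro std_module_homogeneous_basis \<open>field F\<close>) auto
    show "r (s \<gamma>) = frag_of \<gamma>"
      unfolding s_def r[OF S] using graded_space.degrees_eq[OF P[OF S] B] by simp
  qed
  \<comment> \<open>Two encodings of the finitely supported integer functions on
    \<open>carrier \<Gamma>\<close>.\<close>
  moreover have "free_Abelian_group (carrier \<Gamma>) \<cong> sum_group (carrier \<Gamma>) (\<lambda>\<gamma>. integer_group)"
    by (rule group.iso_sym[OF _ isomorphic_sum_integer_group]) simp
  ultimately show ?thesis
    unfolding K0gr_def Let_def Z_def N_def R_def cls_def \<P>_def by (rule iso_trans)
qed

end
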